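(* The Wang shift $\Omega_\mathcal{Z}$ generated by the set $\mathcal{Z}$ of 16 Wang tiles described in the context is self-similar, minimal and aperiodic.
   Context: A Wang tile is a 4-tuple of colors read as (east, north, west, south) edge labels. $\mathcal{Z}=\{z_0,\dots,z_{15}\}$ with $z_0=(D,O,J,O)$, $z_1=(D,O,H,L)$, $z_2=(J,M,D,P)$, $z_3=(D,M,D,K)$, $z_4=(H,P,J,P)$, $z_5=(H,P,H,N)$, $z_6=(H,K,D,P)$, $z_7=(B,O,I,O)$, $z_8=(I,L,E,O)$, $z_9=(I,L,C,L)$, $z_{10}=(A,L,I,O)$, $z_{11}=(E,P,I,P)$, $z_{12}=(I,P,I,K)$, $z_{13}=(I,K,B,M)$, $z_{14}=(I,K,A,K)$, $z_{15}=(C,N,I,P)$. $\Omega_\mathcal{Z}$ is the set of maps $f:\mathbb{Z}^2\to\{0,\dots,15\}$ such that for all ${\boldsymbol{n}}$ the east label of $z_{f({\boldsymbol{n}})}$ equals the west label of $z_{f({\boldsymbol{n}}+e_1)}$ and the north label of $z_{f({\boldsymbol{n}})}$ equals the south label of $z_{f({\boldsymbol{n}}+e_2)}$; it is a subshift under the shift action $\sigma$ of $\mathbb{Z}^2$, $(\sigma^{\boldsymbol{k}}f)({\boldsymbol{n}})=f({\boldsymbol{n}}+{\boldsymbol{k}})$. A 2-dimensional morphism $\omega$ on an alphabet $\mathcal{A}$ assigns to each letter a rectangular 2-dimensional word over $\mathcal{A}$ such that it extends to configurations $y$ of a subshift $X$ by concatenating the images $\omega(y_{\boldsymbol{n}})$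 according to positions (images of letters in a common column have equal width, in a common row equal height), with $\omega(y_{(0,0)})$ having its lower-left corner at the origin. It is expansive if the width and height of $\omega^k(a)$ tend to $\infty$ for every letter $a$. A subshift $X\subseteq\mathcal{A}^{\mathbb{Z}^2}$ is self-similar if there exists an expansive 2-dimensional morphism $\omega:\mathcal{A}\to\mathcal{A}^{*^2}$ with $X=\overline{\omega(X)}^\sigma:=\{\sigma^{\boldsymbol{k}}\omega(y): {\boldsymbol{k}}\in\mathbb{Z}^2, y\in X\}$. $X$ is minimal if it is nonempty and has no nonempty proper closed shift-invariant subset. $X$ is aperiodic if it is nonempty and no $y\in X$ satisfies $\sigma^{\boldsymbol{k}}y=y$ for some ${\boldsymbol{k}}\neq(0,0)$. *)

theory Defs
  imports "HOL-Analysis.Analysis"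
begin

type_synonym 'a config = "int \<times> int \<Rightarrow> 'a"

definition shift :: "int \<times> int \<Rightarrow> 'a config \<Rightarrow> 'a config" where
  "shift k f = (\<lambda>n. f (n + k))"

definition shift_invariant :: "'a config set \<Rightarrow> bool" where
  "shift_invariant X \<longleftrightarrow> (\<forall>k. shift k ` X = X)"

text \<open>
  Closedness refers to the product topology on \<^typ>\<open>'a config\<close> of the discrete topology on the
  alphabet. Since \<open>A\<close> is clopen in its type, a subset of \<open>A\<close>-valued configurations is closed here
  iff it is closed relative to them.
\<close>

definition subshift :: "'a::discrete_topology set \<Rightarrow> 'a config set \<Rightarrow> bool" where
  "subshift A X \<longleftrightarrow> (\<forall>f\<in>X. \<forall>n. f n \<in> A) \<and> closed X \<and> shift_invariant X"

definition minimal_subshift :: "'a::discrete_topology config set \<Rightarrow> bool" where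
  "minimal_subshift X \<longleftrightarrow>
     X \<noteq> {} \<and> \<not> (\<exists>Y. Y \<noteq> {} \<and> Y \<subset> X \<and> closed Y \<and> shift_invariant Y)"

definition aperiodic_subshift :: "'a config set \<Rightarrow> bool" where
  "aperiodic_subshift X \<longleftrightarrow> X \<noteq> {} \<and> \<not> (\<exists>y\<in>X. \<exists>k. k \<noteq> (0, 0) \<and> shift k y = y)"

text \<open>
  Only the letters at positions \<open>(i, j)\<close> with \<open>0 \<le> i < width\<close> and \<open>0 \<le> j < height\<close> are
  meaningful; \<open>(0, 0)\<close> is the lower-left corner. Keeping the letters as a total function on
  \<^typ>\<open>int \<times> int\<close> lets finite words and configurations share the definitions below.
\<close>

datatype 'a word2 = Word2 (width: nat) (height: nat) (letters: "'a config")

text \<open>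
  Consecutive blocks of lengths \<open>\<dots>, g (-1), g 0, g 1, \<dots>\<close>, with block \<open>0\<close> starting at position
  \<open>0\<close>: \<open>block_start g m\<close> is the first position of block \<open>m\<close> (one of the two sums is empty), and
  \<open>block_of g p\<close> is the block that contains position \<open>p\<close>.
\<close>

definition block_start :: "(int \<Rightarrow> nat) \<Rightarrow> int \<Rightarrow> int" where
  "block_start g m = (\<Sum>i\<in>{0..<m}. int (g i)) - (\<Sum>i\<in>{m..<0}. int (g i))"

definition block_of :: "(int \<Rightarrow> nat) \<Rightarrow> int \<Rightarrow> int" where
  "block_of g p = (THE m. block_start g m \<le> p \<and> p < block_start g (m + 1))"

definition concatenable ::
  "('a \<Rightarrow> 'b word2) \<Rightarrow> int set \<Rightarrow> int set \<Rightarrow> 'a config \<Rightarrow> bool" where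
  "concatenable \<omega> C R y \<longleftrightarrow>
     (\<forall>m\<in>C. \<forall>n\<in>R. \<forall>n'\<in>R. width (\<omega> (y (m, n))) = width (\<omega> (y (m, n')))) \<and>
     (\<forall>n\<in>R. \<forall>m\<in>C. \<forall>m'\<in>C. height (\<omega> (y (m, n))) = height (\<omega> (y (m', n))))"

text \<open>
  For a concatenable \<open>y\<close> the width of a column and the height of a row can be read off in
  row \<open>0\<close> and column \<open>0\<close>.
\<close>

definition col_width :: "('a \<Rightarrow> 'b word2) \<Rightarrow> 'a config \<Rightarrow> int \<Rightarrow> nat" where
  "col_width \<omega> y m = width (\<omega> (y (m, 0)))"

definition row_height :: "('a \<Rightarrow> 'b word2) \<Rightarrow> 'a config \<Rightarrow> int \<Rightarrow> nat" where
  "row_height \<omega> y n = height (\<omega> (y (0, n)))"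

definition extend_config :: "('a \<Rightarrow> 'b word2) \<Rightarrow> 'a config \<Rightarrow> 'b config" where
  "extend_config \<omega> y = (\<lambda>(p, q).
     let m = block_of (col_width \<omega> y) p; n = block_of (row_height \<omega> y) q
     in letters (\<omega> (y (m, n)))
          (p - block_start (col_width \<omega> y) m, q - block_start (row_height \<omega> y) n))"

definition extend_word :: "('a \<Rightarrow> 'b word2) \<Rightarrow> 'a word2 \<Rightarrow> 'b word2" where
  "extend_word \<omega> u = Word2
     (\<Sum>i<width u. col_width \<omega> (letters u) (int i))
     (\<Sum>j<height u. row_height \<omega> (letters u) (int j))
     (extend_config \<omega> (letters u))"

definition concatenable_word :: "('a \<Rightarrow> 'b word2) \<Rightarrow> 'a word2 \<Rightarrow> bool" where
  "concatenable_word \<omega> u \<longleftrightarrow>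
     concatenable \<omega> {0..<int (width u)} {0..<int (height u)} (letters u)"

definition iterate_letter :: "('a \<Rightarrow> 'a word2) \<Rightarrow> nat \<Rightarrow> 'a \<Rightarrow> 'a word2" where
  "iterate_letter \<omega> k a = (extend_word \<omega> ^^ k) (Word2 1 1 (\<lambda>_. a))"

text \<open>
  Images of letters are required to be nonempty. This is no restriction for expansive morphisms:
  if \<open>\<omega> a\<close> is empty, then so is every \<open>\<omega>\<^sup>k a\<close> with \<open>k \<ge> 1\<close>.
\<close>

definition morphism2_on :: "'a set \<Rightarrow> 'a config set \<Rightarrow> ('a \<Rightarrow> 'a word2) \<Rightarrow> bool" where
  "morphism2_on A X \<omega> \<longleftrightarrow>
     (\<forall>a\<in>A. 0 < width (\<omega> a) \<and> 0 < height (\<omega> a) \<and>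
        (\<forall>i\<in>{0..<int (width (\<omega> a))}. \<forall>j\<in>{0..<int (height (\<omega> a))}. letters (\<omega> a) (i, j) \<in> A)) \<and>
     (\<forall>y\<in>X. concatenable \<omega> UNIV UNIV y)"

text \<open>The first conjunct says that all the words \<open>\<omega>\<^sup>k a\<close> are well defined.\<close>

definition expansive :: "'a set \<Rightarrow> ('a \<Rightarrow> 'a word2) \<Rightarrow> bool" where
  "expansive A \<omega> \<longleftrightarrow> (\<forall>a\<in>A.
     (\<forall>k. concatenable_word \<omega> (iterate_letter \<omega> k a)) \<and>
     filterlim (\<lambda>k. width (iterate_letter \<omega> k a)) at_top sequentially \<and>
     filterlim (\<lambda>k. height (iterate_letter \<omega> k a)) at_top sequentially)"

definition self_similar :: "'a::discrete_topology set \<Rightarrow> 'a config set \<Rightarrow> bool" where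
  "self_similar A X \<longleftrightarrow> subshift A X \<and>
     (\<exists>\<omega>. morphism2_on A X \<omega> \<and> expansive A \<omega> \<and>
        X = {shift k (extend_config \<omega> y) | k y. y \<in> X})"

datatype color = cA | cB | cC | cD | cE | cH | cI | cJ | cK | cL | cM | cN | cO | cP

datatype 'c wang_tile = Tile (east: 'c) (north: 'c) (west: 'c) (south: 'c)

definition wang_shift :: "'c wang_tile list \<Rightarrow> nat config set" where
  "wang_shift T = {f.
     (\<forall>n. f n < length T) \<and>
     (\<forall>n. east (T ! f n) = west (T ! f (n + (1, 0)))) \<and>
     (\<forall>n. north (T ! f n) = south (T ! f (n + (0, 1))))}"

definition Z_tiles :: "color wang_tile list" where
  "Z_tiles =
    [Tile cD cO cJ cO,
     Tile cD cO cH cL,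
     Tile cJ cM cD cP,
     Tile cD cM cD cK,
     Tile cH cP cJ cP,
     Tile cH cP cH cN,
     Tile cH cK cD cP,
     Tile cB cO cI cO,
     Tile cI cL cE cO,
     Tile cI cL cC cL,
     Tile cA cL cI cO,
     Tile cE cP cI cP,
     Tile cI cP cI cK,
     Tile cI cK cB cM,
     Tile cI cK cA cK,
     Tile cC cN cI cP]"

end

theory Submission
  imports Defs
begin

text \<open>
  In a valid configuration, the tiles \<open>0, 1, 7, 8, 9, 10\<close> fill whole columns, the tiles
  \<open>0, \<dots>, 6\<close> fill whole rows, and no two such columns or rows are adjacent. Gluing each of these
  columns to its left neighbour and each of these rows to the row below cuts the configuration
  into blocks of side \<open>1\<close> or \<open>2\<close>. Exactly 16 blocks occur, and their boundary labels match like
  those of the 16 tiles themselves, which gives the substitution \<open>omega\<close> and shows that it can be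
  undone. A period of a configuration descends to a period of its preimage that is shorter by a
  factor \<open>2/3\<close>, hence there is none. For minimality, every \<open>2 \<times> 2\<close> pattern that occurs somewhere
  is generated by \<open>omega\<close> from the letter \<open>12\<close>, which occurs everywhere; a larger pattern is
  reduced to a smaller one by undoing \<open>omega\<close> twice.
\<close>

section \<open>Forbidden dominoes\<close>

text \<open>
  A neighbour table lists, for each tile, the tiles that may follow it in one direction. The
  refinement of \<open>h\<close> keeps a horizontal domino iff it extends upwards and downwards to
  \<open>2 \<times> 2\<close> squares allowed by \<open>h\<close> and \<open>v\<close>; exchanging the roles of \<open>h\<close> and \<open>v\<close> refines
  vertical dominoes.
\<close>

definition refine :: "nat list list \<Rightarrow> nat list list \<Rightarrow> nat list list" where
  "refine h v = map (\<lambda>a. filter (\<lambda>b.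
      list_ex (\<lambda>c. list_ex (\<lambda>d. d \<in> set (h ! c)) (v ! b)) (v ! a) \<and>
      list_ex (\<lambda>c. a \<in> set (v ! c) \<and> list_ex (\<lambda>d. b \<in> set (v ! d)) (h ! c)) [0..<16])
    (h ! a)) [0..<16]"

definition east_raw :: "nat list list" where
  "east_raw = map (\<lambda>a. filter (\<lambda>b. east (Z_tiles ! a) = west (Z_tiles ! b)) [0..<16]) [0..<16]"

definition north_raw :: "nat list list" where
  "north_raw = map (\<lambda>a. filter (\<lambda>b. north (Z_tiles ! a) = south (Z_tiles ! b)) [0..<16]) [0..<16]"

definition east_nbrs :: "nat list list" where
  "east_nbrs = [[3], [2,3,6], [0,4], [6], [1], [1], [1,5], [13], [12], [11,12], [14], [8],
     [7,10,11,15], [7,11,12], [7,11], [9]]"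

definition north_nbrs :: "nat list list" where
  "north_nbrs = [[7], [7,8,10], [13], [13], [11], [11], [12,14], [0,8,10], [1,9], [1], [1,9],
     [4,6,15], [2,6,11,15], [3,12,14], [3,12], [5]]"

text \<open>The labels already keep whole columns and whole rows apart in the sense of
  \<open>narrow\<close> and \<open>low\<close> below, but they let tile \<open>7\<close> follow tile
  \<open>8\<close> eastwards and tile \<open>0\<close> sit on tile \<open>0\<close>. Two alternating
  rounds remove all such adjacent pairs.\<close>

lemma nbrs_refine:
  "let h = refine east_raw north_raw; v = refine north_raw h; h' = refine h v; v' = refine v h'
   in h' = east_nbrs \<and> v' = north_nbrs"
  by code_simp

section \<open>The substitution\<close>

text \<open>These are the tiles with north and south labels among \<open>cO\<close> and
  \<open>cL\<close>. They have two roles: their images are one cell wide, and they are the letters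
  found in the second columns of images. \<open>low\<close>, with east and west labels
  \<open>cD\<close>, \<open>cH\<close>, \<open>cJ\<close>, has the same roles for rows.\<close>

definition narrow :: "nat \<Rightarrow> bool" where
  "narrow a \<longleftrightarrow> a \<in> set [0, 1, 7, 8, 9, 10]"

definition low :: "nat \<Rightarrow> bool" where
  "low a \<longleftrightarrow> a < 7"

definition wd :: "nat \<Rightarrow> nat" where
  "wd a = (if narrow a then 1 else 2)"

definition ht :: "nat \<Rightarrow> nat" where
  "ht a = (if low a then 1 else 2)"

text \<open>
  The rows of each image are listed from bottom to top, so that \<open>cell a i j\<close> is the letter at
  position \<open>(i, j)\<close>. The widths and heights \<open>wd a\<close>, \<open>ht a\<close> are positive even for \<open>a \<ge> 16\<close>, which
  keeps \<^const>\<open>block_of\<close> meaningful for the irrelevant letters outside finite words.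
\<close>

definition omega_rows :: "nat list list list" where
  "omega_rows =
    [[[14]], [[13]], [[12, 10]], [[11, 8]], [[14, 7]], [[13, 7]], [[12, 7]],
     [[12], [6]], [[14], [3]], [[13], [3]], [[12], [2]],
     [[12, 10], [6, 1]], [[11, 8], [6, 1]], [[15, 9], [5, 1]], [[11, 8], [4, 1]],
     [[12, 7], [2, 0]]]"

definition cell :: "nat \<Rightarrow> nat \<Rightarrow> nat \<Rightarrow> nat" where
  "cell a i j = omega_rows ! a ! j ! i"

section \<open>Finite checks on the substitution and its blocks\<close>

lemma all_less_upt: "(\<forall>a<n. P a) \<longleftrightarrow> (\<forall>a\<in>set [0..<n]. P a)"
  and ex_less_upt: "(\<exists>a<n. P a) \<longleftrightarrow> (\<exists>a\<in>set [0..<n]. P a)"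
  for n :: nat
  by auto

lemma east_nbrs_props:
  "\<forall>a<16. \<forall>b\<in>set (east_nbrs ! a).
     b < 16 \<and> (low b \<longleftrightarrow> low a) \<and> \<not> (narrow a \<and> narrow b)"
  by code_simp

lemma north_nbrs_props:
  "\<forall>a<16. \<forall>b\<in>set (north_nbrs ! a).
     b < 16 \<and> (narrow b \<longleftrightarrow> narrow a) \<and> \<not> (low a \<and> low b)"
  by code_simp

text \<open>Letters reveal their place in a block, so the cut into blocks can be read off a
  configuration. The adjacency conjuncts give legality inside one image; the seam lemmas give it
  between two images.\<close>

lemma cell_props:
  "\<forall>a<16. \<forall>i<wd a. \<forall>j<ht a.
     cell a i j < 16 \<and> (narrow (cell a i j) \<longleftrightarrow> i = 1) \<and> (low (cell a i j) \<longleftrightarrow> j = 1) \<and>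
     (i + 1 < wd a \<longrightarrow> cell a (i + 1) j \<in> set (east_nbrs ! cell a i j)) \<and>
     (j + 1 < ht a \<longrightarrow> cell a i (j + 1) \<in> set (north_nbrs ! cell a i j))"
  by code_simp

lemma seam_east:
  "\<forall>a<16. \<forall>b\<in>set (east_nbrs ! a). \<forall>j<ht a.
     cell b 0 j \<in> set (east_nbrs ! cell a (wd a - 1) j)"
  by code_simp

lemma seam_north:
  "\<forall>a<16. \<forall>b\<in>set (north_nbrs ! a). \<forall>i<wd a.
     cell b i 0 \<in> set (north_nbrs ! cell a i (ht a - 1))"
  by code_simp

lemma cell_inject:
  "\<forall>a<16. \<forall>b<16. wd a = wd b \<longrightarrow> ht a = ht b \<longrightarrow>
     (\<forall>i<wd a. \<forall>j<ht a. cell a i j = cell b i j) \<longrightarrow> a = b"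
  unfolding all_less_upt ex_less_upt by code_simp

text \<open>Used to undo \<open>omega\<close>. Equality of labels is the natural conclusion here:
  the preimage enters the Wang shift through its labels, and the refined tables then follow
  globally.\<close>

lemma seam_east_reflect:
  "\<forall>a<16. \<forall>b<16. ht a = ht b \<longrightarrow>
     (\<forall>j<ht a. cell b 0 j \<in> set (east_nbrs ! cell a (wd a - 1) j)) \<longrightarrow>
     east (Z_tiles ! a) = west (Z_tiles ! b)"
  unfolding all_less_upt ex_less_upt by code_simp

lemma seam_north_reflect:
  "\<forall>a<16. \<forall>b<16. wd a = wd b \<longrightarrow>
     (\<forall>i<wd a. cell b i 0 \<in> set (north_nbrs ! cell a i (ht a - 1))) \<longrightarrow>
     north (Z_tiles ! a) = south (Z_tiles ! b)"
  unfolding all_less_upt ex_less_upt by code_simp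

text \<open>\<open>t\<close> is the first cell of a block, which also contains \<open>r\<close> if
  \<open>r\<close> is narrow and \<open>u\<close> if \<open>u\<close> is low. The diagonal cell
  \<open>v\<close> matters even outside the block: a block consisting of \<open>12\<close> alone is
  excluded because no \<open>v\<close> completes the square.\<close>

lemma block_exists:
  "\<forall>t<16. \<not> narrow t \<longrightarrow> \<not> low t \<longrightarrow>
    (\<forall>r\<in>set (east_nbrs ! t). \<forall>u\<in>set (north_nbrs ! t). \<forall>v\<in>set (north_nbrs ! r).
      v \<in> set (east_nbrs ! u) \<longrightarrow>
      (\<exists>a<16. wd a = (if narrow r then 2 else 1) \<and> ht a = (if low u then 2 else 1) \<and>
         cell a 0 0 = t \<and> (narrow r \<longrightarrow> cell a 1 0 = r) \<and> (low u \<longrightarrow> cell a 0 1 = u) \<and>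
         (narrow r \<longrightarrow> low u \<longrightarrow> cell a 1 1 = v)))"
  unfolding all_less_upt ex_less_upt by code_simp

definition letters_hit :: "nat list \<Rightarrow> nat list \<Rightarrow> bool" where
  "letters_hit S S' \<longleftrightarrow> (\<forall>a\<in>set S. \<exists>i<wd a. \<exists>j<ht a. cell a i j \<in> set S')"

text \<open>
  The second and third lists consist of the letters whose second and first image, respectively,
  contain the letter \<open>12\<close>.
\<close>

lemma letters_hit_chain:
  "letters_hit [0..<16] [2, 3, 4, 5, 6, 7, 10, 11, 12, 13, 14, 15]"
  "letters_hit [2, 3, 4, 5, 6, 7, 10, 11, 12, 13, 14, 15] [2, 6, 7, 10, 11, 15]"
  "letters_hit [2, 6, 7, 10, 11, 15] [12]"
  by code_simp+

type_synonym quad = "nat \<times> nat \<times> nat \<times> nat"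

text \<open>
  A quad \<open>(a, b, c, d)\<close> is the \<open>2 \<times> 2\<close> pattern with lower row \<open>a b\<close> and upper row \<open>c d\<close>.
  Squares of its image are only collected if their lower left corner lies in the image of \<open>a\<close>.
\<close>

definition quad_cell :: "quad \<Rightarrow> nat \<Rightarrow> nat \<Rightarrow> nat" where
  "quad_cell = (\<lambda>(a, b, c, d) i j.
     if i < wd a then if j < ht a then cell a i j else cell c i (j - ht a)
     else if j < ht a then cell b (i - wd a) j else cell d (i - wd a) (j - ht a))"

definition quad_image :: "quad \<Rightarrow> quad list" where
  "quad_image Q = concat (map (\<lambda>i. map (\<lambda>j.
     (quad_cell Q i j, quad_cell Q (i + 1) j, quad_cell Q i (j + 1), quad_cell Q (i + 1) (j + 1)))
     [0..<ht (fst Q)]) [0..<wd (fst Q)])"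

definition legal_quads :: "quad list" where
  "legal_quads = concat (map (\<lambda>a. concat (map (\<lambda>b. concat (map (\<lambda>c.
     map (\<lambda>d. (a, b, c, d)) (filter (\<lambda>d. d \<in> set (east_nbrs ! c)) (north_nbrs ! b)))
     (north_nbrs ! a))) (east_nbrs ! a))) [0..<16])"

text \<open>Breadth-first search: \<open>K\<close> holds the quads found so far and \<open>F\<close>
  the quads whose images are examined next. The counter bounds the number of rounds.\<close>

fun explore :: "nat \<Rightarrow> quad list \<Rightarrow> quad list \<Rightarrow> quad list" where
  "explore 0 K F = K"
| "explore (Suc n) K F =
     (let F' = remdups (filter (\<lambda>Q. Q \<notin> set K) (concat (map quad_image F))) in explore n (F' @ K) F')"

text \<open>The seed is the complete image of the letter \<open>12\<close>. By desubstitution every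
  pattern that occurs lies in the image of a legal quad, so the inclusion shows that it is generated
  from \<open>12\<close>.\<close>

lemma quad_image_explore:
  "set (concat (map quad_image legal_quads)) \<subseteq> set (explore 7 [(11, 8, 6, 1)] [(11, 8, 6, 1)])"
  by code_simp

section \<open>Blocks on the integers\<close>

lemma block_start_0 [simp]: "block_start g 0 = 0"
  by (simp add: block_start_def)

lemma block_start_Suc: "block_start g (m + 1) = block_start g m + int (g m)"
proof (cases "0 \<le> m")
  case True
  then have "{0..<m + 1} = insert m {0..<m}" by auto
  with True show ?thesis by (simp add: block_start_def)
next
  case False
  then have "{m..<0} = insert m {m + 1..<0}" by auto
  with False show ?thesis by (simp add: block_start_def)
qed

lemma block_start_minus_1: "block_start g (m - 1) = block_start g m - int (g (m - 1))"
  using block_start_Suc[of g "m - 1"] by simp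

lemma block_start_of_nat: "block_start g (int n) = (\<Sum>i<n. int (g (int i)))"
proof (induction n)
  case (Suc n)
  then show ?case using block_start_Suc[of g "int n"] by (simp add: add.commute)
qed simp

lemma block_start_unique:
  assumes "\<And>m. s (m + 1) = s m + int (g m)"
  shows "s m = s 0 + block_start g m"
proof (induction m rule: int_induct[where k = 0])
  case (step2 i)
  then show ?case
    using block_start_minus_1[of g i] assms[of "i - 1"] by simp
qed (simp_all add: assms block_start_Suc)

lemma block_start_cong:
  assumes "\<And>m. n \<le> m \<Longrightarrow> m < n + M \<Longrightarrow> g m = h (m - n + k)" and "0 \<le> i" "i \<le> M"
  shows "block_start g (n + i) - block_start g n = block_start h (k + i) - block_start h k"
  using assms(2,3)
proof (induction i rule: int_ge_induct)
  case (step i)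
  have "g (n + i) = h (k + i)" using assms(1)[of "n + i"] step by (simp add: add.commute)
  then show ?case
    using step block_start_Suc[of g "n + i"] block_start_Suc[of h "k + i"]
    by (simp add: add.assoc)
qed simp

lemma block_start_mono:
  assumes "m \<le> n"
  shows "block_start g m \<le> block_start g n"
  using assms by (induction n rule: int_ge_induct) (auto simp: block_start_Suc)

lemma block_start_diff_ge:
  assumes "\<And>m. 0 < g m" and "m \<le> n"
  shows "n - m \<le> block_start g n - block_start g m"
  using assms(2)
proof (induction n rule: int_ge_induct)
  case (step i)
  then show ?case using assms(1)[of i] block_start_Suc[of g i] by linarith
qed simp

lemma block_of_eqI:
  assumes "block_start g m \<le> p" "p < block_start g (m + 1)"
  shows "block_of g p = m"
  unfolding block_of_def
proof (rule the_equality)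
  fix n assume n: "block_start g n \<le> p \<and> p < block_start g (n + 1)"
  show "n = m"
  proof (rule ccontr)
    assume "n \<noteq> m"
    then consider "n + 1 \<le> m" | "m + 1 \<le> n" by linarith
    then show False
      by cases (use block_start_mono[of _ _ g] n assms in fastforce)+
  qed
qed (use assms in simp)

lemma block_of_block_start_add:
  assumes "0 \<le> i" "i < int (g m)"
  shows "block_of g (block_start g m + i) = m"
  using assms by (intro block_of_eqI) (auto simp: block_start_Suc)

lemma block_of_bounds:
  assumes pos: "\<And>m. 0 < g m"
  shows "block_start g (block_of g p) \<le> p \<and> p < block_start g (block_of g p) + int (g (block_of g p))"
proof -
  have "\<exists>m. block_start g m \<le> p \<and> p < block_start g m + int (g m)"
  proof (induction p rule: int_induct[where k = 0])
    case base
    show ?case using pos[of 0] by (intro exI[of _ 0]) simp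
  next
    case (step1 p)
    then obtain m where m: "block_start g m \<le> p" "p < block_start g m + int (g m)" by blast
    show ?case
    proof (cases "p + 1 < block_start g m + int (g m)")
      case False
      with m show ?thesis
        using pos[of "m + 1"] block_start_Suc[of g m] by (intro exI[of _ "m + 1"]) linarith
    qed (use m in \<open>intro exI[of _ m], simp\<close>)
  next
    case (step2 p)
    then obtain m where m: "block_start g m \<le> p" "p < block_start g m + int (g m)" by blast
    show ?case
    proof (cases "block_start g m \<le> p - 1")
      case False
      with m show ?thesis
        using pos[of "m - 1"] block_start_minus_1[of g m] by (intro exI[of _ "m - 1"]) linarith
    qed (use m in \<open>intro exI[of _ m], simp\<close>)
  qed
  then show ?thesis using block_of_eqI[of g _ p] block_start_Suc by metis
qed

lemma block_cases:
  assumes "\<And>m. 0 < g m"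
  obtains m i where "p = block_start g m + int i" "i < g m" "block_of g p = m"
proof -
  let ?m = "block_of g p"
  have "p = block_start g ?m + int (nat (p - block_start g ?m))" "nat (p - block_start g ?m) < g ?m"
    using block_of_bounds[of g p, OF assms] by auto
  then show ?thesis using that by blast
qed

lemma block_of_Suc:
  assumes "\<And>m. 0 < g m"
  shows "block_of g (p + 1) =
    (if p + 1 = block_start g (block_of g p + 1) then block_of g p + 1 else block_of g p)"
  using block_of_bounds[of g p, OF assms] assms[of "block_of g p + 1"]
    block_start_Suc[of g "block_of g p"] block_start_Suc[of g "block_of g p + 1"]
  by (auto intro!: block_of_eqI)

lemma block_of_less_iff:
  assumes "\<And>m. 0 < g m"
  shows "block_of g p < m \<longleftrightarrow> p < block_start g m"
proof
  assume "block_of g p < m"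
  then have "block_start g (block_of g p + 1) \<le> block_start g m" by (intro block_start_mono) simp
  then show "p < block_start g m"
    using block_of_bounds[of g p, OF assms] block_start_Suc[of g "block_of g p"] by linarith
next
  assume "p < block_start g m"
  then have "\<not> block_start g m \<le> block_start g (block_of g p)"
    using block_of_bounds[of g p, OF assms] by linarith
  then show "block_of g p < m" using block_start_mono[of m "block_of g p" g] by linarith
qed

lemma block_of_mono:
  assumes "\<And>m. 0 < g m" "p \<le> q"
  shows "block_of g p \<le> block_of g q"
  using block_of_less_iff[of g, OF assms(1)] assms(2) block_of_bounds[of g p, OF assms(1)]
  by (meson le_less_trans not_less order.trans)

text \<open>The lengths \<open>1\<close> and \<open>2\<close> with isolated \<open>1\<close>s give at least three cells per two blocks.\<close>

lemma block_start_double: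
  assumes g: "\<And>m. 3 \<le> g m + g (m + 1)" and "0 \<le> k"
  shows "3 * k \<le> block_start g (2 * k)" "block_start g (- 2 * k) \<le> - 3 * k"
proof -
  show "3 * k \<le> block_start g (2 * k)"
    using assms(2)
  proof (induction k rule: int_ge_induct)
    case (step i)
    then show ?case
      using g[of "2 * i"] block_start_Suc[of g "2 * i"] block_start_Suc[of g "2 * i + 1"]
      by (simp add: algebra_simps)
  qed simp
  show "block_start g (- 2 * k) \<le> - 3 * k"
    using assms(2)
  proof (induction k rule: int_ge_induct)
    case (step i)
    have "- 2 * (i + 1) + 1 + 1 = - 2 * i" by simp
    then show ?case
      using step g[of "- 2 * (i + 1)"] block_start_Suc[of g "- 2 * (i + 1)"]
        block_start_Suc[of g "- 2 * (i + 1) + 1"]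
      by (simp add: algebra_simps)
  qed simp
qed

text \<open>Applying the translation twice makes the number of blocks even: \<open>2 * r\<close>
  blocks span \<open>2 * p\<close> cells, and they can be counted in pairs.\<close>

lemma block_period_contracts:
  assumes g: "\<And>m. 3 \<le> g m + g (m + 1)"
    and period: "\<And>m. block_start g (m + r) = block_start g m + p"
  shows "3 * \<bar>r\<bar> \<le> 2 * \<bar>p\<bar>"
proof -
  have "block_start g (2 * r) = 2 * p" using period[of 0] period[of r] by simp
  then show ?thesis
    using block_start_double[of g r, OF g] block_start_double[of g "- r", OF g]
    by (cases "0 \<le> r") auto
qed

text \<open>
  \<open>c\<close> marks the second cells of the blocks of length \<open>2\<close>, so that the unmarked cells are the
  block starts.
\<close>

lemma enumerate_blocks:
  fixes c :: "int \<Rightarrow> bool"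
  assumes iso: "\<And>p. \<not> (c p \<and> c (p + 1))"
  shows "\<exists>s. \<forall>m :: int. \<not> c (s m) \<and> s (m + 1) = s m + int (if c (s m + 1) then 2 else 1)"
proof -
  \<comment> \<open>\<open>nx\<close> and \<open>pv\<close> go to the next and the previous unmarked
    cell. As marks are isolated, these are one or two steps away, and \<open>nx\<close> undoes
    \<open>pv\<close> on unmarked cells.\<close>
  define nx where "nx p = p + int (if c (p + 1) then 2 else 1)" for p
  define pv where "pv p = (if c (p - 1) then p - 2 else p - 1)" for p
  obtain p0 where p0: "\<not> c p0" using iso by blast
  have nx: "\<not> c (nx p)" if "\<not> c p" for p
    using iso[of "p + 1"] that by (auto simp: nx_def add.assoc)
  have pv: "\<not> c (pv p)" "nx (pv p) = p" if "\<not> c p" for p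
    using iso[of "p - 2"] that by (auto simp: nx_def pv_def)
  define s where "s m = (if 0 \<le> m then (nx ^^ nat m) p0 else (pv ^^ nat (- m)) p0)" for m
  have nxs: "\<not> c ((nx ^^ n) p0)" for n by (induction n) (use p0 nx in auto)
  have pvs: "\<not> c ((pv ^^ n) p0)" for n by (induction n) (use p0 pv in auto)
  have "s (m + 1) = nx (s m)" for m
  proof (cases "0 \<le> m")
    case True
    then show ?thesis by (simp add: s_def nat_add_distrib)
  next
    case False
    then have "nat (- m) = Suc (nat (- m - 1))" by simp
    then have "s m = pv ((pv ^^ nat (- m - 1)) p0)" using False by (simp add: s_def)
    moreover have "s (m + 1) = (pv ^^ nat (- m - 1)) p0"
      using False by (cases "m = - 1") (auto simp: s_def)
    ultimately show ?thesis using pv pvs by simp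
  qed
  moreover have "\<not> c (s m)" for m using nxs pvs by (simp add: s_def)
  ultimately show ?thesis unfolding nx_def by (intro exI[of _ s]) simp
qed

section \<open>Legal configurations and desubstitution\<close>

definition nbrs :: "nat list list \<Rightarrow> nat list list \<Rightarrow> nat config \<Rightarrow> bool" where
  "nbrs h v f \<longleftrightarrow> (\<forall>m n. f (m, n) < 16 \<and>
     f (m + 1, n) \<in> set (h ! f (m, n)) \<and> f (m, n + 1) \<in> set (v ! f (m, n)))"

lemma nbrs_swap: "nbrs h v f \<Longrightarrow> nbrs v h (\<lambda>(m, n). f (n, m))"
  by (simp add: nbrs_def)

text \<open>The rows directly above and below a domino of \<open>f\<close> supply the witnesses that
  \<open>refine\<close> asks for.\<close>

lemma nbrs_refine_east:
  assumes "nbrs h v f"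
  shows "nbrs (refine h v) v f"
  unfolding nbrs_def
proof (intro allI conjI)
  fix m n
  let ?a = "f (m, n)" and ?b = "f (m + 1, n)"
  show lt: "f (m, n) < 16" and "f (m, n + 1) \<in> set (v ! f (m, n))"
    using assms by (auto simp: nbrs_def)
  have up: "f (m, n + 1) \<in> set (v ! ?a)" "f (m + 1, n + 1) \<in> set (v ! ?b)"
      "f (m + 1, n + 1) \<in> set (h ! f (m, n + 1))"
    using assms by (auto simp: nbrs_def)
  have down: "f (m, n - 1) < 16" "?a \<in> set (v ! f (m, n - 1))"
      "?b \<in> set (v ! f (m + 1, n - 1))" "f (m + 1, n - 1) \<in> set (h ! f (m, n - 1))"
    using assms[unfolded nbrs_def, rule_format, of m "n - 1"]
      assms[unfolded nbrs_def, rule_format, of "m + 1" "n - 1"] by auto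
  have "?b \<in> set (h ! ?a)" using assms by (auto simp: nbrs_def)
  with up down lt show "?b \<in> set (refine h v ! ?a)"
    by (fastforce simp: refine_def list_ex_iff simp del: upt_rec_numeral)
qed

lemma nbrs_refine_north:
  assumes "nbrs h v f"
  shows "nbrs h (refine v h) f"
  using nbrs_swap[OF nbrs_refine_east[OF nbrs_swap[OF assms]]] by (simp add: case_prod_beta)

lemma length_Z_tiles [simp]: "length Z_tiles = 16"
  by (simp add: Z_tiles_def)

lemma raw_nth:
  assumes "a < 16"
  shows "b \<in> set (east_raw ! a) \<longleftrightarrow> b < 16 \<and> east (Z_tiles ! a) = west (Z_tiles ! b)"
    "b \<in> set (north_raw ! a) \<longleftrightarrow> b < 16 \<and> north (Z_tiles ! a) = south (Z_tiles ! b)"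
  using assms by (auto simp: east_raw_def north_raw_def simp del: upt_rec_numeral)

lemma wang_shift_nbrs: "wang_shift Z_tiles = {f. nbrs east_raw north_raw f}"
proof -
  have "f \<in> wang_shift Z_tiles \<longleftrightarrow> nbrs east_raw north_raw f" if "\<And>n. f n < 16" for f
    using that by (auto simp: wang_shift_def nbrs_def raw_nth)
  moreover have "f n < 16" if "f \<in> wang_shift Z_tiles \<or> nbrs east_raw north_raw f" for f n
    using that by (cases n) (auto simp: wang_shift_def nbrs_def)
  ultimately show ?thesis by blast
qed

text \<open>A domino is tested only if both its cells lie in \<open>C\<close> and \<open>R\<close>.
  Thus finite words and configurations of the whole plane share one notion.\<close>

definition legal :: "int set \<Rightarrow> int set \<Rightarrow> nat config \<Rightarrow> bool" where
  "legal C R f \<longleftrightarrow> (\<forall>m\<in>C. \<forall>n\<in>R. f (m, n) < 16 \<and>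
     (m + 1 \<in> C \<longrightarrow> f (m + 1, n) \<in> set (east_nbrs ! f (m, n))) \<and>
     (n + 1 \<in> R \<longrightarrow> f (m, n + 1) \<in> set (north_nbrs ! f (m, n))))"

lemma nbrs_matching:
  "\<forall>a<16. (\<forall>b\<in>set (east_nbrs ! a). b \<in> set (east_raw ! a)) \<and>
     (\<forall>b\<in>set (north_nbrs ! a). b \<in> set (north_raw ! a))"
  by code_simp

text \<open>Refinement discards only dominoes that no configuration contains, and the remaining ones
  still match by their labels.\<close>

lemma wang_shift_legal: "wang_shift Z_tiles = {f. legal UNIV UNIV f}"
proof -
  have "nbrs east_raw north_raw f = nbrs east_nbrs north_nbrs f" for f
  proof
    assume f: "nbrs east_raw north_raw f"
    let ?h = "refine east_raw north_raw" and ?v = "refine north_raw (refine east_raw north_raw)"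
    have "nbrs (refine ?h ?v) (refine ?v (refine ?h ?v)) f"
      by (intro nbrs_refine_north nbrs_refine_east f)
    moreover have "refine ?h ?v = east_nbrs" "refine ?v (refine ?h ?v) = north_nbrs"
      using nbrs_refine unfolding Let_def by blast+
    ultimately show "nbrs east_nbrs north_nbrs f" by metis
  next
    assume "nbrs east_nbrs north_nbrs f"
    then show "nbrs east_raw north_raw f" using nbrs_matching by (fastforce simp: nbrs_def)
  qed
  then show ?thesis by (auto simp: wang_shift_nbrs legal_def nbrs_def)
qed

lemma legalD:
  assumes "legal C R f" "m \<in> C" "n \<in> R"
  shows "f (m, n) < 16"
    "m + 1 \<in> C \<Longrightarrow> f (m + 1, n) \<in> set (east_nbrs ! f (m, n))"
    "n + 1 \<in> R \<Longrightarrow> f (m, n + 1) \<in> set (north_nbrs ! f (m, n))"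
    "m + 1 \<in> C \<Longrightarrow> low (f (m + 1, n)) = low (f (m, n))"
    "n + 1 \<in> R \<Longrightarrow> narrow (f (m, n + 1)) = narrow (f (m, n))"
    "m + 1 \<in> C \<Longrightarrow> \<not> (narrow (f (m, n)) \<and> narrow (f (m + 1, n)))"
    "n + 1 \<in> R \<Longrightarrow> \<not> (low (f (m, n)) \<and> low (f (m, n + 1)))"
proof -
  show 16: "f (m, n) < 16"
    and e: "m + 1 \<in> C \<Longrightarrow> f (m + 1, n) \<in> set (east_nbrs ! f (m, n))"
    and n: "n + 1 \<in> R \<Longrightarrow> f (m, n + 1) \<in> set (north_nbrs ! f (m, n))"
    using assms by (auto simp: legal_def)
  show "m + 1 \<in> C \<Longrightarrow> low (f (m + 1, n)) = low (f (m, n))"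
    "m + 1 \<in> C \<Longrightarrow> \<not> (narrow (f (m, n)) \<and> narrow (f (m + 1, n)))"
    using east_nbrs_props 16 e by blast+
  show "n + 1 \<in> R \<Longrightarrow> narrow (f (m, n + 1)) = narrow (f (m, n))"
    "n + 1 \<in> R \<Longrightarrow> \<not> (low (f (m, n)) \<and> low (f (m, n + 1)))"
    using north_nbrs_props 16 n by blast+
qed

definition int_interval :: "int set \<Rightarrow> bool" where
  "int_interval C \<longleftrightarrow> (\<forall>a\<in>C. \<forall>b\<in>C. {a..b} \<subseteq> C)"

lemma int_interval_simps [simp]: "int_interval UNIV" "int_interval {a..<b}"
  by (auto simp: int_interval_def)

lemma int_interval_const:
  assumes C: "int_interval C" and "\<And>n. n \<in> C \<Longrightarrow> n + 1 \<in> C \<Longrightarrow> P (n + 1) = P n"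
    and "a \<in> C" "b \<in> C"
  shows "P b = P a"
proof -
  have *: "P b = P a" if "a \<le> b" "a \<in> C" "b \<in> C" for a b
    using that
  proof (induction b rule: int_ge_induct)
    case (step b)
    then have "b \<in> C" using C by (force simp: int_interval_def)
    then show ?case using step assms(2) by simp
  qed simp
  show ?thesis using *[of a b] *[of b a] assms(3,4) by (cases "a \<le> b") auto
qed

lemma legal_narrow_column:
  assumes "legal C R f" "int_interval R" "m \<in> C" "n \<in> R" "n' \<in> R"
  shows "narrow (f (m, n)) = narrow (f (m, n'))"
  by (rule int_interval_const[where C = R]) (use assms legalD(5) in auto)

lemma legal_low_row:
  assumes "legal C R f" "int_interval C" "m \<in> C" "m' \<in> C" "n \<in> R"
  shows "low (f (m, n)) = low (f (m', n))"
  by (rule int_interval_const[where C = C]) (use assms legalD(4) in auto)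

section \<open>The action of \<open>omega\<close> on legal configurations\<close>

definition omega :: "nat \<Rightarrow> nat word2" where
  "omega a = Word2 (wd a) (ht a) (\<lambda>(i, j). cell a (nat i) (nat j))"

lemma omega_simps [simp]:
  "width (omega a) = wd a" "height (omega a) = ht a"
  "letters (omega a) (int i, int j) = cell a i j"
  by (simp_all add: omega_def)

lemma wd_pos [simp]: "0 < wd a" and ht_pos [simp]: "0 < ht a"
  by (simp_all add: wd_def ht_def)

abbreviation colw :: "nat config \<Rightarrow> int \<Rightarrow> nat" where
  "colw \<equiv> col_width omega"

abbreviation rowh :: "nat config \<Rightarrow> int \<Rightarrow> nat" where
  "rowh \<equiv> row_height omega"

abbreviation ext :: "nat config \<Rightarrow> nat config" where
  "ext \<equiv> extend_config omega"

lemma colw_pos [simp]: "0 < colw y m" and rowh_pos [simp]: "0 < rowh y n"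
  by (simp_all add: col_width_def row_height_def)

lemma legal_cols:
  assumes "legal C R y" "int_interval R" "m \<in> C" "n \<in> R" "0 \<in> R"
  shows "colw y m = wd (y (m, n))"
  using legal_narrow_column[OF assms] by (simp add: col_width_def wd_def)

lemma legal_rows:
  assumes "legal C R y" "int_interval C" "m \<in> C" "n \<in> R" "0 \<in> C"
  shows "rowh y n = ht (y (m, n))"
  using legal_low_row[OF assms(1-3) assms(5) assms(4)] by (simp add: row_height_def ht_def)

lemma legal_concatenable:
  assumes "legal C R y" "int_interval C" "int_interval R"
  shows "concatenable omega C R y"
  unfolding concatenable_def omega_simps wd_def ht_def
proof (intro conjI ballI)
  fix m n n' assume "m \<in> C" "n \<in> R" "n' \<in> R"
  then show "(if narrow (y (m, n)) then 1 else 2) = (if narrow (y (m, n')) then 1 else 2 :: nat)"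
    using legal_narrow_column[OF assms(1,3)] by metis
next
  fix n m m' assume "n \<in> R" "m \<in> C" "m' \<in> C"
  then show "(if low (y (m, n)) then 1 else 2) = (if low (y (m', n)) then 1 else 2 :: nat)"
    using legal_low_row[OF assms(1,2)] by metis
qed

lemma ext_block:
  assumes "i < colw y m" "j < rowh y n"
  shows "ext y (block_start (colw y) m + int i, block_start (rowh y) n + int j) = cell (y (m, n)) i j"
  using assms
  by (simp add: extend_config_def Let_def block_of_block_start_add)

lemma ext_block_start:
  "ext y (block_start (colw y) m, block_start (rowh y) n) = cell (y (m, n)) 0 0"
  using ext_block[of 0 y m 0 n] by simp

text \<open>Two adjacent cells of the image lie either in one block, where \<open>cell_props\<close>
  applies, or on both sides of a seam between adjacent letters. Column widths and row heights are
  read in row and column \<open>0\<close>, which therefore have to belong to the region.\<close>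

lemma legal_ext:
  assumes y: "legal C R y" and C: "int_interval C" "0 \<in> C" and R: "int_interval R" "0 \<in> R"
  shows "legal {p. block_of (colw y) p \<in> C} {q. block_of (rowh y) q \<in> R} (ext y)"
  unfolding legal_def
proof (intro ballI)
  fix p q assume pq: "p \<in> {p. block_of (colw y) p \<in> C}" "q \<in> {q. block_of (rowh y) q \<in> R}"
  let ?c = "block_start (colw y)" and ?r = "block_start (rowh y)"
  obtain m i where m: "p = ?c m + int i" "i < colw y m" "block_of (colw y) p = m"
    using block_cases[of "colw y" p] by auto
  obtain n j where n: "q = ?r n + int j" "j < rowh y n" "block_of (rowh y) q = n"
    using block_cases[of "rowh y" q] by auto
  have mn: "m \<in> C" "n \<in> R" using pq m n by auto
  let ?a = "y (m, n)"
  have a: "?a < 16" using legalD(1)[OF y mn] .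
  have w: "colw y m = wd ?a" and h: "rowh y n = ht ?a"
    using legal_cols[OF y R(1) mn R(2)] legal_rows[OF y C(1) mn C(2)] by auto
  have at: "ext y (p, q) = cell ?a i j" using ext_block m n by simp
  have cell: "cell ?a i j < 16"
      "i + 1 < wd ?a \<Longrightarrow> cell ?a (i + 1) j \<in> set (east_nbrs ! cell ?a i j)"
      "j + 1 < ht ?a \<Longrightarrow> cell ?a i (j + 1) \<in> set (north_nbrs ! cell ?a i j)"
    using cell_props a m n w h by auto
  have east: "ext y (p + 1, q) \<in> set (east_nbrs ! ext y (p, q))" if "block_of (colw y) (p + 1) \<in> C"
  proof (cases "i + 1 < colw y m")
    case True
    have "p + 1 = ?c m + int (i + 1)" using m by simp
    with True have "ext y (p + 1, q) = cell ?a (i + 1) j" using ext_block n by metis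
    with True show ?thesis using cell at w by simp
  next
    case False
    then have p1: "p + 1 = ?c (m + 1) + int 0" using m by (simp add: block_start_Suc)
    then have m1: "m + 1 \<in> C" using that block_of_block_start_add[of 0 "colw y" "m + 1"] by simp
    have "ext y (p + 1, q) = cell (y (m + 1, n)) 0 j"
      unfolding p1 n(1) by (rule ext_block) (use n in auto)
    moreover have "i = wd ?a - 1" using False m w by simp
    moreover have "y (m + 1, n) \<in> set (east_nbrs ! ?a)" using legalD(2)[OF y mn m1] .
    ultimately show ?thesis using seam_east a n h at by auto
  qed
  have north: "ext y (p, q + 1) \<in> set (north_nbrs ! ext y (p, q))" if "block_of (rowh y) (q + 1) \<in> R"
  proof (cases "j + 1 < rowh y n")
    case True
    have "q + 1 = ?r n + int (j + 1)" using n by simp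
    with True have "ext y (p, q + 1) = cell ?a i (j + 1)" using ext_block m by metis
    with True show ?thesis using cell at h by simp
  next
    case False
    then have q1: "q + 1 = ?r (n + 1) + int 0" using n by (simp add: block_start_Suc)
    then have n1: "n + 1 \<in> R" using that block_of_block_start_add[of 0 "rowh y" "n + 1"] by simp
    have "ext y (p, q + 1) = cell (y (m, n + 1)) i 0"
      unfolding q1 m(1) by (rule ext_block) (use m in auto)
    moreover have "j = ht ?a - 1" using False n h by simp
    moreover have "y (m, n + 1) \<in> set (north_nbrs ! ?a)" using legalD(3)[OF y mn n1] .
    ultimately show ?thesis using seam_north a m w at by auto
  qed
  show "ext y (p, q) < 16 \<and>
    (p + 1 \<in> {p. block_of (colw y) p \<in> C} \<longrightarrow> ext y (p + 1, q) \<in> set (east_nbrs ! ext y (p, q))) \<and>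
    (q + 1 \<in> {q. block_of (rowh y) q \<in> R} \<longrightarrow> ext y (p, q + 1) \<in> set (north_nbrs ! ext y (p, q)))"
    using cell at east north by simp
qed

abbreviation X :: "nat config set" where
  "X \<equiv> wang_shift Z_tiles"

lemma X_legal: "f \<in> X \<longleftrightarrow> legal UNIV UNIV f"
  by (simp add: wang_shift_legal)

lemmas X_D = legalD[of UNIV UNIV, folded X_legal, simplified]

lemma ext_X: "y \<in> X \<Longrightarrow> ext y \<in> X"
  using legal_ext[of UNIV UNIV y] by (simp add: X_legal)

lemma shift_apply [simp]: "shift (k, l) f (m, n) = f (m + k, n + l)"
  by (simp add: shift_def)

lemma shift_shift: "shift k (shift l f) = shift (k + l) f"
  by (simp add: shift_def add.assoc)

lemma shift_X: "f \<in> X \<Longrightarrow> shift k f \<in> X"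
proof (cases k)
  case (Pair a b)
  have *: "m + 1 + a = m + a + 1" "m + 1 + b = m + b + 1" for m by simp_all
  assume "f \<in> X"
  then show ?thesis unfolding X_legal Pair legal_def by (simp add: *)
qed

lemma X_cols: "y \<in> X \<Longrightarrow> colw y m = wd (y (m, n))"
  by (rule legal_cols[of UNIV UNIV]) (auto simp: X_legal)

lemma X_rows: "y \<in> X \<Longrightarrow> rowh y n = ht (y (m, n))"
  by (rule legal_rows[of UNIV UNIV]) (auto simp: X_legal)

lemma X_narrow: "y \<in> X \<Longrightarrow> narrow (y (m, n)) = narrow (y (m, n'))"
  by (rule legal_narrow_column[of UNIV UNIV]) (auto simp: X_legal)

lemma X_low: "y \<in> X \<Longrightarrow> low (y (m, n)) = low (y (m', n))"
  by (rule legal_low_row[of UNIV UNIV]) (auto simp: X_legal)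

text \<open>Narrow columns and low rows are exactly the second columns and rows of blocks. This
  fixes the cut points \<open>s\<close> and \<open>t\<close>; each resulting block is the image of a
  letter by \<open>block_exists\<close>.\<close>

lemma desubstitution:
  assumes f: "f \<in> X"
  obtains y k where "y \<in> X" "f = shift k (ext y)"
proof -
  define c where "c p \<longleftrightarrow> narrow (f (p, 0))" for p
  define r where "r q \<longleftrightarrow> low (f (0, q))" for q
  define cl where "cl p = (if c (p + 1) then 2 else 1 :: nat)" for p
  define rl where "rl q = (if r (q + 1) then 2 else 1 :: nat)" for q
  have c: "narrow (f (p, q)) = c p" for p q unfolding c_def by (rule X_narrow[OF f])
  have r: "low (f (p, q)) = r q" for p q unfolding r_def by (rule X_low[OF f])
  have iso: "\<not> (c p \<and> c (p + 1))" "\<not> (r p \<and> r (p + 1))" for p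
    using X_D(6)[OF f, of p 0] X_D(7)[OF f, of 0 p] by (auto simp: c_def r_def)
  have "\<exists>s. \<forall>m :: int. \<not> c (s m) \<and> s (m + 1) = s m + int (cl (s m))"
    unfolding cl_def by (rule enumerate_blocks[of c, OF iso(1)])
  then obtain s where s': "\<forall>m :: int. \<not> c (s m) \<and> s (m + 1) = s m + int (cl (s m))" by (rule exE)
  have s: "\<not> c (s m)" "s (m + 1) = s m + int (cl (s m))" for m using s' by auto
  have "\<exists>t. \<forall>n :: int. \<not> r (t n) \<and> t (n + 1) = t n + int (rl (t n))"
    unfolding rl_def by (rule enumerate_blocks[of r, OF iso(2)])
  then obtain t where t': "\<forall>n :: int. \<not> r (t n) \<and> t (n + 1) = t n + int (rl (t n))" by (rule exE)
  have t: "\<not> r (t n)" "t (n + 1) = t n + int (rl (t n))" for n using t' by auto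
  have "\<exists>a<16. wd a = cl (s m) \<and> ht a = rl (t n) \<and>
      (\<forall>i<wd a. \<forall>j<ht a. cell a i j = f (s m + int i, t n + int j))" for m n
  proof -
    let ?p = "s m" and ?q = "t n"
    have q: "f (?p, ?q) < 16" "\<not> narrow (f (?p, ?q))" "\<not> low (f (?p, ?q))"
      "f (?p + 1, ?q) \<in> set (east_nbrs ! f (?p, ?q))"
      "f (?p, ?q + 1) \<in> set (north_nbrs ! f (?p, ?q))"
      "f (?p + 1, ?q + 1) \<in> set (north_nbrs ! f (?p + 1, ?q))"
      "f (?p + 1, ?q + 1) \<in> set (east_nbrs ! f (?p, ?q + 1))"
      using X_D[OF f] c r s t by auto
    obtain a where a: "a < 16" "wd a = (if narrow (f (?p + 1, ?q)) then 2 else 1)"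
        "ht a = (if low (f (?p, ?q + 1)) then 2 else 1)" "cell a 0 0 = f (?p, ?q)"
        "narrow (f (?p + 1, ?q)) \<longrightarrow> cell a 1 0 = f (?p + 1, ?q)"
        "low (f (?p, ?q + 1)) \<longrightarrow> cell a 0 1 = f (?p, ?q + 1)"
        "narrow (f (?p + 1, ?q)) \<longrightarrow> low (f (?p, ?q + 1)) \<longrightarrow> cell a 1 1 = f (?p + 1, ?q + 1)"
      using block_exists[rule_format, OF q] by (elim exE conjE)
    have "cell a i j = f (?p + int i, ?q + int j)" if "i < wd a" "j < ht a" for i j
    proof -
      have "(i = 0 \<or> i = 1 \<and> c (?p + 1)) \<and> (j = 0 \<or> j = 1 \<and> r (?q + 1))"
        using that a(2,3) c r by (auto split: if_splits)
      then show ?thesis using a(4-7) c r by auto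
    qed
    then show ?thesis using a c r by (intro exI[of _ a]) (simp add: cl_def rl_def)
  qed
  then obtain y0 where y0: "\<And>m n. y0 m n < 16 \<and> wd (y0 m n) = cl (s m) \<and> ht (y0 m n) = rl (t n) \<and>
      (\<forall>i<wd (y0 m n). \<forall>j<ht (y0 m n). cell (y0 m n) i j = f (s m + int i, t n + int j))"
    by metis
  define y where "y = (\<lambda>(m, n). y0 m n)"
  have y: "y (m, n) < 16" "wd (y (m, n)) = cl (s m)" "ht (y (m, n)) = rl (t n)"
    and cell: "i < cl (s m) \<Longrightarrow> j < rl (t n) \<Longrightarrow> cell (y (m, n)) i j = f (s m + int i, t n + int j)"
    for m n i j using y0[of m n] by (auto simp: y_def)
  \<comment> \<open>Legality of \<open>f\<close> across the common border of two blocks is carried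
    back to the labels of their letters.\<close>
  have "east (Z_tiles ! y (m, n)) = west (Z_tiles ! y (m + 1, n))" for m n
  proof -
    let ?a = "y (m, n)" and ?b = "y (m + 1, n)"
    have "cell ?b 0 j \<in> set (east_nbrs ! cell ?a (wd ?a - 1) j)" if "j < ht ?a" for j
    proof -
      have "s m + int (wd ?a - 1) + 1 = s (m + 1)" using s(2)[of m] y(2)[of m n]
        by (simp add: cl_def)
      moreover have "cell ?a (wd ?a - 1) j = f (s m + int (wd ?a - 1), t n + int j)"
        using that y(2,3)[of m n] by (intro cell) (auto simp: cl_def)
      moreover have "cell ?b 0 j = f (s (m + 1) + int 0, t n + int j)"
        using that y(3)[of m n] by (intro cell) (auto simp: cl_def)
      ultimately show ?thesis
        using X_D(2)[OF f, of "s m + int (wd ?a - 1)" "t n + int j"] by simp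
    qed
    then show ?thesis using seam_east_reflect y(1)[of m n] y(1)[of "m + 1" n] y(3)
      by simp
  qed
  moreover have "north (Z_tiles ! y (m, n)) = south (Z_tiles ! y (m, n + 1))" for m n
  proof -
    let ?a = "y (m, n)" and ?b = "y (m, n + 1)"
    have "cell ?b i 0 \<in> set (north_nbrs ! cell ?a i (ht ?a - 1))" if "i < wd ?a" for i
    proof -
      have "t n + int (ht ?a - 1) + 1 = t (n + 1)" using t(2)[of n] y(3)[of m n]
        by (simp add: rl_def)
      moreover have "cell ?a i (ht ?a - 1) = f (s m + int i, t n + int (ht ?a - 1))"
        using that y(2,3)[of m n] by (intro cell) (auto simp: rl_def)
      moreover have "cell ?b i 0 = f (s m + int i, t (n + 1) + int 0)"
        using that y(2)[of m n] by (intro cell) (auto simp: rl_def)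
      ultimately show ?thesis
        using X_D(3)[OF f, of "s m + int i" "t n + int (ht ?a - 1)"] by simp
    qed
    then show ?thesis using seam_north_reflect y(1)[of m n] y(1)[of m "n + 1"] y(2)
      by simp
  qed
  ultimately have yX: "y \<in> X" using y(1) by (auto simp: wang_shift_def)
  have colw: "colw y m = cl (s m)" and rowh: "rowh y n = rl (t n)" for m n
    using y by (simp_all add: col_width_def row_height_def)
  \<comment> \<open>The cut points of \<open>f\<close> and the block starts of \<open>ext y\<close>
    obey the same recursion, so they differ by the constant \<open>s 0\<close>. This is where the
    shift by \<open>(- s 0, - t 0)\<close> comes from.\<close>
  have sb: "s m = s 0 + block_start (colw y) m" for m
    by (rule block_start_unique) (use s(2) colw in simp)
  have tb: "t n = t 0 + block_start (rowh y) n" for n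
    by (rule block_start_unique) (use t(2) rowh in simp)
  have "f (p, q) = shift (- s 0, - t 0) (ext y) (p, q)" for p q
  proof -
    obtain m i where m: "p - s 0 = block_start (colw y) m + int i" "i < colw y m"
      using block_cases[of "colw y" "p - s 0", OF colw_pos] by blast
    obtain n j where n: "q - t 0 = block_start (rowh y) n + int j" "j < rowh y n"
      using block_cases[of "rowh y" "q - t 0", OF rowh_pos] by blast
    have "ext y (p - s 0, q - t 0) = cell (y (m, n)) i j"
      unfolding m(1) n(1) using m n by (intro ext_block)
    also have "\<dots> = f (s m + int i, t n + int j)"
      using m n colw rowh by (intro cell) auto
    also have "s m + int i = p" using m sb[of m] by simp
    also have "t n + int j = q" using n tb[of n] by simp
    finally show ?thesis by simp
  qed
  then have "f = shift (- s 0, - t 0) (ext y)" by auto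
  then show ?thesis using that yX by blast
qed

section \<open>Self-similarity and aperiodicity\<close>

text \<open>Positive side lengths put \<open>(0, 0)\<close>, where widths and heights are read,
  inside the word.\<close>

definition good_word :: "nat word2 \<Rightarrow> bool" where
  "good_word u \<longleftrightarrow> 0 < width u \<and> 0 < height u \<and>
     legal {0..<int (width u)} {0..<int (height u)} (letters u)"

lemma good_word_extend:
  assumes "good_word u"
  shows "good_word (extend_word omega u)"
    and "int (width (extend_word omega u)) = block_start (colw (letters u)) (int (width u))"
    and "int (height (extend_word omega u)) = block_start (rowh (letters u)) (int (height u))"
proof -
  let ?y = "letters u" and ?w = "int (width u)" and ?h = "int (height u)"
  show w: "int (width (extend_word omega u)) = block_start (colw ?y) ?w"
    and h: "int (height (extend_word omega u)) = block_start (rowh ?y) ?h"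
    by (simp_all add: extend_word_def block_start_of_nat)
  have pos: "0 < ?w" "0 < ?h" and u: "legal {0..<?w} {0..<?h} ?y"
    using assms by (auto simp: good_word_def)
  have range: "{p. block_of g p \<in> {0..<n}} = {0..<block_start g n}" if "\<And>m. 0 < g m" for g n
    using block_of_less_iff[of g _ 0, OF that] block_of_less_iff[of g _ n, OF that]
    by (auto simp flip: not_less)
  have "legal {p. block_of (colw ?y) p \<in> {0..<?w}} {q. block_of (rowh ?y) q \<in> {0..<?h}} (ext ?y)"
    by (rule legal_ext[OF u]) (use pos in simp_all)
  then have "legal {0..<block_start (colw ?y) ?w} {0..<block_start (rowh ?y) ?h} (ext ?y)"
    unfolding range[OF colw_pos] range[OF rowh_pos] .
  moreover have "?w \<le> block_start (colw ?y) ?w" "?h \<le> block_start (rowh ?y) ?h"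
    using block_start_diff_ge[of "colw ?y" 0 ?w] block_start_diff_ge[of "rowh ?y" 0 ?h] by simp_all
  ultimately show "good_word (extend_word omega u)"
    using w h pos by (simp add: good_word_def) (simp add: extend_word_def)
qed

lemma good_word_letter: "a < 16 \<Longrightarrow> good_word (Word2 1 1 (\<lambda>_. a))"
  by (simp add: good_word_def legal_def)

lemma block_start_first_two:
  assumes "\<And>m. 0 < g m" "g 0 = 2" "0 < n"
  shows "n < block_start g n"
  using block_start_diff_ge[of g 1 n, OF assms(1)] block_start_Suc[of g 0] assms by simp

text \<open>From the first iterate on, the corner letter is the first cell of a block, hence neither
  narrow nor low. Its own image is \<open>2\<close> by \<open>2\<close>, so every further iteration
  enlarges both sides. The letter \<open>a\<close> itself may be narrow or low, so strict growth
  starts one step late.\<close>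

lemma iterate_letter_large:
  assumes a: "a < 16"
  defines "u \<equiv> \<lambda>k. iterate_letter omega k a"
  shows "good_word (u k)" "k \<le> width (u k)" "k \<le> height (u k)"
proof -
  have Suc: "u (Suc k) = extend_word omega (u k)" for k by (simp add: u_def iterate_letter_def)
  have good: "good_word (u k)" for k
  proof (induction k)
    case 0
    then show ?case using good_word_letter[OF a] by (simp add: u_def iterate_letter_def)
  qed (simp add: Suc good_word_extend)
  then show "good_word (u k)" .
  have corner: "\<not> narrow (letters (u (Suc k)) (0, 0)) \<and> \<not> low (letters (u (Suc k)) (0, 0))" for k
  proof -
    have "letters (u k) (0, 0) < 16"
      using good[of k] by (simp add: good_word_def legal_def)
    moreover have "letters (u (Suc k)) (0, 0) = cell (letters (u k) (0, 0)) 0 0"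
      using ext_block_start[of "letters (u k)" 0 0] by (simp add: Suc extend_word_def)
    ultimately show ?thesis using cell_props by auto
  qed
  have grow: "width (u (Suc k)) < width (u (Suc (Suc k))) \<and> height (u (Suc k)) < height (u (Suc (Suc k)))"
    for k
  proof -
    let ?u = "u (Suc k)"
    have "colw (letters ?u) 0 = 2" "rowh (letters ?u) 0 = 2"
      using corner[of k] by (simp_all add: col_width_def row_height_def wd_def ht_def)
    then have "int (width ?u) < int (width (extend_word omega ?u))"
      "int (height ?u) < int (height (extend_word omega ?u))"
      using good[of "Suc k"] unfolding good_word_extend[OF good]
      by (intro block_start_first_two; simp add: good_word_def)+
    then show ?thesis by (simp add: Suc)
  qed
  have "k \<le> width (u k) \<and> k \<le> height (u k)"
  proof (induction k)
    case (Suc k)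
    then show ?case
      using grow[of "k - 1"] good[of "Suc k"] by (cases k) (auto simp: good_word_def)
  qed simp
  then show "k \<le> width (u k)" "k \<le> height (u k)" by simp_all
qed

lemma expansive_omega: "expansive {0..15} omega"
  unfolding expansive_def
proof (intro ballI conjI allI)
  fix a k :: nat assume "a \<in> {0..15}"
  then have a: "a < 16" by simp
  show "concatenable_word omega (iterate_letter omega k a)"
    using iterate_letter_large(1)[OF a, of k]
    by (simp add: concatenable_word_def good_word_def legal_concatenable)
  show "filterlim (\<lambda>k. width (iterate_letter omega k a)) at_top sequentially"
    "filterlim (\<lambda>k. height (iterate_letter omega k a)) at_top sequentially"
    using iterate_letter_large(2,3)[OF a]
    by (auto intro!: filterlim_at_top_mono[OF filterlim_ident] always_eventually)
qed

section \<open>Closedness, compactness and existence of a configuration\<close>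

lemma closed_pair_condition:
  fixes n n' :: "int \<times> int"
  shows "closed {f :: nat config. P (f n) (f n')}"
proof -
  have coord: "open {f :: nat config. f i \<in> A}" for i A
    using open_vimage[OF open_discrete[of A] continuous_on_product_coordinates[of i]]
    by (simp add: vimage_def)
  \<comment> \<open>Fixing the value at \<open>n\<close> writes the complement as a union of open
    cylinders.\<close>
  have "- {f :: nat config. P (f n) (f n')} = (\<Union>a. {f. f n \<in> {a}} \<inter> {f. f n' \<in> {b. \<not> P a b}})"
    by auto
  also have "open \<dots>" by (intro open_UN ballI open_Int coord)
  finally show ?thesis by (simp add: closed_def)
qed

lemma closed_legal: "closed {f. legal C R f}"
proof -
  have "{f. legal C R f} = (\<Inter>m\<in>C. \<Inter>n\<in>R. {f. f (m, n) < 16} \<inter>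
      {f. m + 1 \<in> C \<longrightarrow> f (m + 1, n) \<in> set (east_nbrs ! f (m, n))} \<inter>
      {f. n + 1 \<in> R \<longrightarrow> f (m, n + 1) \<in> set (north_nbrs ! f (m, n))})"
    by (auto simp: legal_def)
  also have "closed \<dots>"
    by (intro closed_INT ballI closed_Int closed_pair_condition)
  finally show ?thesis .
qed

lemma compact_finite_configs: "compact {f :: nat config. \<forall>n. f n < 16}"
proof -
  have "compactin (product_topology (\<lambda>_ :: int \<times> int. euclidean) UNIV) (PiE UNIV (\<lambda>_. {..<16 :: nat}))"
    by (subst compactin_PiE) (simp add: finite_imp_compact)
  moreover have "PiE UNIV (\<lambda>_ :: int \<times> int. {..<16 :: nat}) = {f. \<forall>n. f n < 16}"
    by (auto simp: PiE_UNIV_domain)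
  ultimately show ?thesis by (simp add: euclidean_product_topology)
qed

text \<open>Compactness: iterated images of a letter give legal words of every size. Centred at the
  origin they show that finitely many of the closed sets \<open>F N\<close> always meet, and a
  common point of all of them is legal everywhere.\<close>

lemma X_nonempty: "X \<noteq> {}"
proof -
  let ?K = "{f :: nat config. \<forall>n. f n < 16}"
  define F where "F N = {f. legal {- int N..<int N} {- int N..<int N} f}" for N
  have mono: "F M \<subseteq> F N" if "N \<le> M" for M N
    using that by (auto simp: F_def legal_def)
  have nonempty: "?K \<inter> F N \<noteq> {}" for N
  proof -
    define u where "u = iterate_letter omega (2 * N) 0"
    have u: "good_word u" "2 * N \<le> width u" "2 * N \<le> height u"
      using iterate_letter_large[of 0 "2 * N"] by (simp_all add: u_def)
    define I where "I = {- int N..<int N}"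
    \<comment> \<open>The window is cut out of the word and recentred; the padding \<open>0\<close>
      is a valid tile index, which keeps \<open>f\<close> in \<open>?K\<close>.\<close>
    define f where "f = (\<lambda>(p, q). if p \<in> I \<and> q \<in> I then letters u (p + int N, q + int N) else 0)"
    have "p + int N \<in> {0..<int (width u)}" "p + int N \<in> {0..<int (height u)}" if "p \<in> I" for p
      using that u by (auto simp: I_def)
    note u' = legalD[OF u(1)[unfolded good_word_def, THEN conjunct2, THEN conjunct2] this(1) this(2)]
    have *: "p + 1 + int N = p + int N + 1" for p by simp
    have in_range: "p + int N + 1 \<in> {0..<int (width u)}" "p + int N + 1 \<in> {0..<int (height u)}"
      if "p + 1 \<in> I" for p
      using that u by (auto simp: I_def)
    have "f \<in> F N"
      unfolding F_def I_def[symmetric] using u'(1-3) in_range by (auto simp: legal_def f_def *)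
    moreover have "f \<in> ?K" using u'(1) by (auto simp: f_def)
    ultimately show ?thesis by blast
  qed
  have "?K \<inter> (\<Inter>N\<in>UNIV. F N) \<noteq> {}"
  proof (rule compact_imp_fip_image[OF compact_finite_configs])
    show "closed (F N)" for N using closed_legal by (simp add: F_def)
    show "?K \<inter> (\<Inter>N\<in>A. F N) \<noteq> {}" if fin: "finite A" for A
    proof -
      obtain M where "\<forall>N\<in>A. N \<le> M" using fin unfolding finite_nat_set_iff_bounded_le by blast
      then have "F M \<subseteq> (\<Inter>N\<in>A. F N)" using mono by (intro INF_greatest) simp
      then show ?thesis using nonempty[of M] by blast
    qed
  qed
  then obtain f where f: "\<And>N. f \<in> F N" by blast
  have "legal UNIV UNIV f"
    unfolding legal_def
  proof (intro ballI)
    fix m n :: int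
    \<comment> \<open>The margin \<open>2\<close> puts \<open>m + 1\<close> and \<open>n + 1\<close>
      into the window too, so that both dominoes at \<open>(m, n)\<close> are tested.\<close>
    define N where "N = nat (\<bar>m\<bar> + \<bar>n\<bar> + 2)"
    have "m \<in> {- int N..<int N}" "n \<in> {- int N..<int N}"
      "m + 1 \<in> {- int N..<int N}" "n + 1 \<in> {- int N..<int N}"
      by (auto simp: N_def)
    moreover have "legal {- int N..<int N} {- int N..<int N} f" using f by (simp add: F_def)
    ultimately show "f (m, n) < 16 \<and>
        (m + 1 \<in> UNIV \<longrightarrow> f (m + 1, n) \<in> set (east_nbrs ! f (m, n))) \<and>
        (n + 1 \<in> UNIV \<longrightarrow> f (m, n + 1) \<in> set (north_nbrs ! f (m, n)))"
      unfolding legal_def by blast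
  qed
  then show ?thesis using X_legal by blast
qed

lemma X_shift_invariant: "shift_invariant X"
  unfolding shift_invariant_def
proof (intro allI set_eqI iffI)
  fix k f assume "f \<in> X"
  then have "shift (- k) f \<in> X" "shift k (shift (- k) f) = f"
    by (simp_all add: shift_X shift_shift) (simp add: shift_def)
  then show "f \<in> shift k ` X" by (metis image_eqI)
qed (auto simp: shift_X)

lemma X_subshift: "subshift {0..15} X"
proof -
  have "f n \<le> 15" if "f \<in> X" for f n
    using X_D(1)[OF that] by (cases n) (fastforce simp: less_Suc_eq_le[symmetric])
  then show ?thesis
    using X_shift_invariant closed_legal[of UNIV UNIV]
    by (auto simp: subshift_def wang_shift_legal)
qed

lemma X_self_similar: "self_similar {0..15} X"
  unfolding self_similar_def
proof (intro conjI X_subshift exI[of _ omega])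
  have "cell a i j \<le> 15" if "a \<le> 15" "i < wd a" "j < ht a" for a i j
    using cell_props[rule_format, of a i j] that by simp
  moreover have "letters (omega a) (i, j) = cell a (nat i) (nat j)" for a i j by (simp add: omega_def)
  ultimately show "morphism2_on {0..15} X omega"
    unfolding morphism2_on_def by (auto simp: X_legal legal_concatenable)
  show "expansive {0..15} omega" by (rule expansive_omega)
  show "X = {shift k (ext y) | k y. y \<in> X}"
  proof (intro set_eqI iffI)
    fix f assume "f \<in> X"
    then obtain y k where "y \<in> X" "f = shift k (ext y)" by (rule desubstitution)
    then show "f \<in> {shift k (ext y) | k y. y \<in> X}" by blast
  qed (auto simp: shift_X ext_X)
qed

section \<open>Descent of periods to the preimage\<close>

lemma X_cols_cases: "colw y m = 1 \<or> colw y m = 2" and X_rows_cases: "rowh y m = 1 \<or> rowh y m = 2"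
  by (auto simp: col_width_def row_height_def wd_def ht_def)

lemma X_cols_double: "y \<in> X \<Longrightarrow> 3 \<le> colw y m + colw y (m + 1)"
  using X_D(6)[of y m 0] by (auto simp: col_width_def wd_def)

lemma X_rows_double: "y \<in> X \<Longrightarrow> 3 \<le> rowh y n + rowh y (n + 1)"
  using X_D(7)[of y 0 n] by (auto simp: row_height_def ht_def)

lemma narrow_low_ext:
  assumes y: "y \<in> X" and i: "i < colw y m" and j: "j < rowh y n"
  shows "narrow (ext y (block_start (colw y) m + int i, q)) \<longleftrightarrow> i = 1"
    "low (ext y (p, block_start (rowh y) n + int j)) \<longleftrightarrow> j = 1"
proof -
  have "narrow (cell (y (m, n)) i j) \<longleftrightarrow> i = 1" "low (cell (y (m, n)) i j) \<longleftrightarrow> j = 1"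
    using cell_props[rule_format, OF X_D(1)[OF y, of m n], of i j] i j
      X_cols[OF y, of m n] X_rows[OF y, of n m] by simp_all
  then show "narrow (ext y (block_start (colw y) m + int i, q)) \<longleftrightarrow> i = 1"
    "low (ext y (p, block_start (rowh y) n + int j)) \<longleftrightarrow> j = 1"
    using X_narrow[OF ext_X[OF y]] X_low[OF ext_X[OF y]] ext_block[OF i j] by metis+
qed

text \<open>The marks \<open>c\<close> are the second cells of blocks. Since \<open>0\<close> is
  unmarked, so is \<open>p\<close>, which makes \<open>p\<close> a block start. The mark after a
  start reveals the length of its block, and the cell before it that of the preceding block; the
  period preserves both.\<close>

lemma period_lift:
  assumes g: "\<And>m. g m = 1 \<or> g m = (2 :: nat)"
    and c0: "\<And>m. \<not> c (block_start g m)" and c1: "\<And>m. g m = 2 \<Longrightarrow> c (block_start g m + 1)"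
    and period: "\<And>x. c (x + p) = c x"
  shows "block_start g (m + block_of g p) = block_start g m + p"
proof -
  have pos: "0 < g m" for m using g[of m] by auto
  have second: "c (block_start g m + 1) \<longleftrightarrow> g m = 2" for m
    using c1[of m] c0[of "m + 1"] g[of m] by (auto simp: block_start_Suc)
  have last: "c (block_start g m - 1) \<longleftrightarrow> g (m - 1) = 2" for m
    using c1[of "m - 1"] c0[of "m - 1"] g[of "m - 1"] by (auto simp: block_start_minus_1)
  let ?r = "block_of g p"
  show ?thesis
  proof (induction m rule: int_induct[where k = 0])
    case base
    have "p = block_start g ?r"
    proof (rule ccontr)
      assume "p \<noteq> block_start g ?r"
      with block_of_bounds[of g p, OF pos] g[of ?r] have "g ?r = 2" "p = block_start g ?r + 1" by auto
      with c1[of ?r] period[of 0] c0[of 0] show False by simp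
    qed
    then show ?case by simp
  next
    case (step1 m)
    have "c (block_start g (m + ?r) + 1) = c (block_start g m + 1)"
      using step1 period[of "block_start g m + 1"] by (simp add: ac_simps)
    then have "g (m + ?r) = g m" using second g by metis
    then show ?case
      using step1 block_start_Suc[of g m] block_start_Suc[of g "m + ?r"] by (simp add: ac_simps)
  next
    case (step2 m)
    have "c (block_start g (m + ?r) - 1) = c (block_start g m - 1)"
      using step2 period[of "block_start g m - 1"] by (simp add: algebra_simps)
    then have "g (m + ?r - 1) = g (m - 1)" using last g by metis
    then show ?case
      using step2 block_start_minus_1[of g m] block_start_minus_1[of g "m + ?r"]
      by (simp add: algebra_simps)
  qed
qed

text \<open>A period of the image maps blocks to blocks of the same shape and content, and such
  blocks come from equal letters by \<open>cell_inject\<close>. The equations for \<open>p\<close>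
  and \<open>q\<close> allow the way back from the shorter period.\<close>

lemma desubstitute_period:
  assumes y: "y \<in> X" and period: "shift (p, q) (ext y) = ext y"
  obtains r s where "shift (r, s) y = y" "3 * \<bar>r\<bar> \<le> 2 * \<bar>p\<bar>" "3 * \<bar>s\<bar> \<le> 2 * \<bar>q\<bar>"
    "block_start (colw y) r = p" "block_start (rowh y) s = q"
proof -
  let ?c = "block_start (colw y)" and ?r = "block_start (rowh y)"
  let ?s = "block_of (colw y) p" and ?t = "block_of (rowh y) q"
  have ext: "ext y (m + p, n + q) = ext y (m, n)" for m n
    using fun_cong[OF period, of "(m, n)"] by simp
  have cs: "?c (m + ?s) = ?c m + p" for m
  proof (rule period_lift[where c = "\<lambda>x. narrow (ext y (x, 0))"])
    show "\<not> narrow (ext y (?c m, 0))" for m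
      using narrow_low_ext(1)[OF y, of 0 m 0 0 0] by simp
    show "narrow (ext y (?c m + 1, 0))" if "colw y m = 2" for m
      using narrow_low_ext(1)[OF y, of 1 m 0 0 0] that by simp
    show "narrow (ext y (x + p, 0)) = narrow (ext y (x, 0))" for x
      using ext[of x 0] X_narrow[OF ext_X[OF y]] by metis
  qed (rule X_cols_cases)
  have rs: "?r (n + ?t) = ?r n + q" for n
  proof (rule period_lift[where c = "\<lambda>x. low (ext y (0, x))"])
    show "\<not> low (ext y (0, ?r n))" for n
      using narrow_low_ext(2)[OF y, of 0 0 0 n 0] by simp
    show "low (ext y (0, ?r n + 1))" if "rowh y n = 2" for n
      using narrow_low_ext(2)[OF y, of 0 0 1 n 0] that by simp
    show "low (ext y (0, x + q)) = low (ext y (0, x))" for x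
      using ext[of 0 x] X_low[OF ext_X[OF y]] by metis
  qed (rule X_rows_cases)
  have "y (m + ?s, n + ?t) = y (m, n)" for m n
  proof -
    let ?a = "y (m + ?s, n + ?t)" and ?b = "y (m, n)"
    have c: "colw y (m + ?s) = colw y m"
      using cs[of m] cs[of "m + 1"] block_start_Suc[of "colw y" m] block_start_Suc[of "colw y" "m + ?s"]
      by (simp add: ac_simps)
    have r: "rowh y (n + ?t) = rowh y n"
      using rs[of n] rs[of "n + 1"] block_start_Suc[of "rowh y" n] block_start_Suc[of "rowh y" "n + ?t"]
      by (simp add: ac_simps)
    have "cell ?a i j = cell ?b i j" if "i < colw y m" "j < rowh y n" for i j
    proof -
      have "cell ?a i j = ext y (?c (m + ?s) + int i, ?r (n + ?t) + int j)"
        by (rule ext_block[symmetric]) (use that c r in simp_all)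
      also have "\<dots> = ext y (?c m + int i + p, ?r n + int j + q)"
        by (simp add: cs rs ac_simps)
      also have "\<dots> = cell ?b i j" using ext ext_block that by simp
      finally show ?thesis .
    qed
    moreover have "wd ?a = wd ?b" "ht ?a = ht ?b"
      using c r X_cols[OF y] X_rows[OF y] by metis+
    ultimately show ?thesis
      using cell_inject[rule_format, OF X_D(1)[OF y] X_D(1)[OF y]]
        X_cols[OF y, of m n] X_rows[OF y, of n m] by simp
  qed
  then have "shift (?s, ?t) y = y" by (auto simp: shift_def)
  moreover have "3 * \<bar>?s\<bar> \<le> 2 * \<bar>p\<bar>"
    by (rule block_period_contracts[OF X_cols_double[OF y] cs])
  moreover have "3 * \<bar>?t\<bar> \<le> 2 * \<bar>q\<bar>"
    by (rule block_period_contracts[OF X_rows_double[OF y] rs])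
  ultimately show ?thesis using that cs[of 0] rs[of 0] by simp
qed

lemma X_no_period:
  assumes "f \<in> X" "shift (p, q) f = f"
  shows "p = 0 \<and> q = 0"
  using assms
proof (induction "nat (\<bar>p\<bar> + \<bar>q\<bar>)" arbitrary: f p q rule: less_induct)
  case less
  obtain y k where y: "y \<in> X" "f = shift k (ext y)" using desubstitution[OF less.prems(1)] .
  have "shift (- k) f = ext y" using y(2) by (simp add: shift_shift) (simp add: shift_def)
  moreover have "shift (p, q) (shift (- k) f) = shift (- k) (shift (p, q) f)"
    by (simp add: shift_shift add.commute)
  ultimately have "shift (p, q) (ext y) = ext y" using less.prems(2) by simp
  then obtain r s where rs: "shift (r, s) y = y" "3 * \<bar>r\<bar> \<le> 2 * \<bar>p\<bar>" "3 * \<bar>s\<bar> \<le> 2 * \<bar>q\<bar>"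
    "block_start (colw y) r = p" "block_start (rowh y) s = q"
    using desubstitute_period[OF y(1)] by blast
  show ?case
  proof (cases "p = 0 \<and> q = 0")
    case False
    then have "0 < \<bar>p\<bar> + \<bar>q\<bar>" by auto
    moreover have "3 * (\<bar>r\<bar> + \<bar>s\<bar>) \<le> 2 * (\<bar>p\<bar> + \<bar>q\<bar>)" using rs(2,3) by simp
    ultimately have "nat (\<bar>r\<bar> + \<bar>s\<bar>) < nat (\<bar>p\<bar> + \<bar>q\<bar>)" by simp
    \<comment> \<open>The period of the preimage is zero by induction; as block \<open>0\<close>
      starts at \<open>0\<close>, the original period vanishes too.\<close>
    then have "r = 0 \<and> s = 0" using less.hyps y(1) rs(1) by blast
    then show ?thesis using rs(4,5) by simp
  qed
qed

lemma X_aperiodic: "aperiodic_subshift X"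
  unfolding aperiodic_subshift_def using X_nonempty X_no_period by fastforce

section \<open>Minimality\<close>

definition hits :: "nat list \<Rightarrow> bool" where
  "hits S \<longleftrightarrow> (\<forall>z\<in>X. \<exists>m n. z (m, n) \<in> set S)"

lemma desubstitution_at:
  assumes "f \<in> X"
  obtains y k l where "y \<in> X" "f = shift (k, l) (ext y)"
proof -
  obtain y k where "y \<in> X" "f = shift k (ext y)" using desubstitution[OF assms] .
  then show ?thesis using that by (cases k) blast
qed

lemma hits_step:
  assumes "hits S" "letters_hit S S'"
  shows "hits S'"
  unfolding hits_def
proof
  fix z assume "z \<in> X"
  then obtain y k l where y: "y \<in> X" "z = shift (k, l) (ext y)" by (rule desubstitution_at)
  obtain m n where mn: "y (m, n) \<in> set S" using assms(1) y(1) unfolding hits_def by blast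
  then obtain i j where ij: "i < wd (y (m, n))" "j < ht (y (m, n))" "cell (y (m, n)) i j \<in> set S'"
    using assms(2) unfolding letters_hit_def by blast
  let ?p = "block_start (colw y) m + int i" and ?q = "block_start (rowh y) n + int j"
  have "z (?p - k, ?q - l) = ext y (?p, ?q)" using y(2) by simp
  also have "\<dots> = cell (y (m, n)) i j"
    using ij X_cols[OF y(1), of m n] X_rows[OF y(1), of n m] by (intro ext_block) simp_all
  finally have "z (?p - k, ?q - l) \<in> set S'" using ij by simp
  then show "\<exists>m n. z (m, n) \<in> set S'" by blast
qed

lemma hits_12: "hits [12]"
proof -
  have "hits [0..<16]" unfolding hits_def using X_D(1) by (simp del: upt_rec_numeral)
  then show ?thesis using hits_step letters_hit_chain by blast
qed

section \<open>Recurrence of \<open>2\<close> by \<open>2\<close> patterns\<close>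

definition quad_at :: "nat config \<Rightarrow> int \<Rightarrow> int \<Rightarrow> quad" where
  "quad_at f m n = (f (m, n), f (m + 1, n), f (m, n + 1), f (m + 1, n + 1))"

lemma quad_cell_ext:
  assumes y: "y \<in> X" and i: "i < colw y m + colw y (m + 1)" and j: "j < rowh y n + rowh y (n + 1)"
  shows "ext y (block_start (colw y) m + int i, block_start (rowh y) n + int j)
    = quad_cell (quad_at y m n) i j"
proof -
  define i' m' where "i' = (if i < colw y m then i else i - colw y m)"
    and "m' = (if i < colw y m then m else m + 1)"
  define j' n' where "j' = (if j < rowh y n then j else j - rowh y n)"
    and "n' = (if j < rowh y n then n else n + 1)"
  have p: "block_start (colw y) m + int i = block_start (colw y) m' + int i'" "i' < colw y m'"
    using i block_start_Suc[of "colw y" m] by (auto simp: i'_def m'_def)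
  have q: "block_start (rowh y) n + int j = block_start (rowh y) n' + int j'" "j' < rowh y n'"
    using j block_start_Suc[of "rowh y" n] by (auto simp: j'_def n'_def)
  have "colw y m = wd (y (m, n))" "rowh y n = ht (y (m, n))"
    using X_cols[OF y] X_rows[OF y] by blast+
  then have "quad_cell (quad_at y m n) i j = cell (y (m', n')) i' j'"
    by (simp add: quad_cell_def quad_at_def i'_def m'_def j'_def n'_def)
  then show ?thesis unfolding p(1) q(1) using ext_block[OF p(2) q(2)] by simp
qed

lemma set_quad_image:
  assumes y: "y \<in> X"
  shows "set (quad_image (quad_at y m n)) =
    {quad_at (ext y) (block_start (colw y) m + int i) (block_start (rowh y) n + int j) | i j.
      i < colw y m \<and> j < rowh y n}"
proof -
  let ?Q = "quad_at y m n"
  have *: "set (quad_image Q) = {(quad_cell Q i j, quad_cell Q (i + 1) j, quad_cell Q i (j + 1),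
      quad_cell Q (i + 1) (j + 1)) | i j. i < wd (fst Q) \<and> j < ht (fst Q)}" for Q
    unfolding quad_image_def by fastforce
  have w: "colw y m = wd (fst ?Q)" "rowh y n = ht (fst ?Q)"
    using X_cols[OF y, of m n] X_rows[OF y, of n m] by (simp_all add: quad_at_def)
  have "quad_at (ext y) (block_start (colw y) m + int i) (block_start (rowh y) n + int j) =
      (quad_cell ?Q i j, quad_cell ?Q (i + 1) j, quad_cell ?Q i (j + 1), quad_cell ?Q (i + 1) (j + 1))"
    if "i < colw y m" "j < rowh y n" for i j
  proof -
    \<comment> \<open>The next block is nonempty, so the square stays within the images of the four
      letters.\<close>
    have "i + 1 < colw y m + colw y (m + 1)" "j + 1 < rowh y n + rowh y (n + 1)"
      using that colw_pos[of y "m + 1"] rowh_pos[of y "n + 1"] by linarith+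
    then show ?thesis
      using quad_cell_ext[OF y, of i m j n] quad_cell_ext[OF y, of "i + 1" m j n]
        quad_cell_ext[OF y, of i m "j + 1" n] quad_cell_ext[OF y, of "i + 1" m "j + 1" n]
      by (simp add: quad_at_def add.assoc add.commute[of 1])
  qed
  then show ?thesis
    unfolding * w by (intro Collect_cong) metis
qed

definition recurrent :: "quad \<Rightarrow> bool" where
  "recurrent Q \<longleftrightarrow> (\<forall>z\<in>X. \<exists>m n. quad_at z m n = Q)"

lemma quad_at_shift: "quad_at (shift (k, l) f) m n = quad_at f (m + k) (n + l)"
  by (simp add: quad_at_def add.assoc add.commute[of 1])

text \<open>Every configuration is a shift of some \<open>ext y\<close>, and a shift only moves the
  place of an occurrence.\<close>

lemma recurrentI:
  assumes "\<And>y. y \<in> X \<Longrightarrow> \<exists>p q. quad_at (ext y) p q = Q"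
  shows "recurrent Q"
  unfolding recurrent_def
proof
  fix z assume "z \<in> X"
  then obtain y k l where y: "y \<in> X" "z = shift (k, l) (ext y)" by (rule desubstitution_at)
  then obtain p q where "quad_at (ext y) p q = Q" using assms by blast
  then have "quad_at z (p - k) (q - l) = Q" using y(2) by (simp add: quad_at_shift)
  then show "\<exists>m n. quad_at z m n = Q" by blast
qed

lemma recurrent_image:
  assumes "recurrent Q" "Q' \<in> set (quad_image Q)"
  shows "recurrent Q'"
proof (rule recurrentI)
  fix y assume y: "y \<in> X"
  then obtain m n where "quad_at y m n = Q" using assms(1) unfolding recurrent_def by blast
  then show "\<exists>p q. quad_at (ext y) p q = Q'" using set_quad_image[OF y, of m n] assms(2) by auto
qed

lemma recurrent_explore:
  assumes "\<forall>Q\<in>set K \<union> set F. recurrent Q"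
  shows "\<forall>Q\<in>set (explore n K F). recurrent Q"
  using assms
proof (induction n K F rule: explore.induct)
  case (2 n K F)
  let ?F' = "remdups (filter (\<lambda>Q. Q \<notin> set K) (concat (map quad_image F)))"
  have "recurrent Q" if "Q \<in> set ?F'" for Q
  proof -
    obtain P where "P \<in> set F" "Q \<in> set (quad_image P)" using \<open>Q \<in> set ?F'\<close> by (simp, blast)
    then show ?thesis using recurrent_image 2(2) by blast
  qed
  then have "\<forall>Q\<in>set (?F' @ K) \<union> set ?F'. recurrent Q" using 2(2) by (simp only: set_append) blast
  then show ?case using 2(1)[OF refl] by (simp only: explore.simps Let_def)
qed simp

lemma recurrent_seed: "recurrent (11, 8, 6, 1)"
proof (rule recurrentI)
  fix y assume y: "y \<in> X"
  then obtain m n where 12: "y (m, n) = 12" using hits_12 by (fastforce simp: hits_def)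
  have w: "wd 12 = 2" "ht 12 = 2" by (simp_all add: wd_def ht_def narrow_def low_def)
  have "quad_at (ext y) (block_start (colw y) m) (block_start (rowh y) n) =
      (cell 12 0 0, cell 12 1 0, cell 12 0 1, cell 12 1 1)"
    using ext_block[of 0 y m 0 n] ext_block[of 1 y m 0 n] ext_block[of 0 y m 1 n]
      ext_block[of 1 y m 1 n] X_cols[OF y, of m n] X_rows[OF y, of n m] w
    by (simp add: quad_at_def 12)
  also have "\<dots> = (11, 8, 6, 1)" by (simp add: cell_def omega_rows_def)
  finally show "\<exists>p q. quad_at (ext y) p q = (11, 8, 6, 1)" by blast
qed

lemma quad_at_legal:
  assumes "f \<in> X"
  shows "quad_at f m n \<in> set legal_quads"
  using X_D(1-3)[OF assms] by (simp add: legal_quads_def quad_at_def image_iff del: upt_rec_numeral)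

text \<open>
  The quad \<open>(9, 12, 1, 2)\<close> is legal but occurs in no configuration; it is not the image of a
  legal quad, which is why a desubstitution step precedes the comparison.
\<close>

lemma quad_at_recurrent:
  assumes "f \<in> X"
  shows "recurrent (quad_at f x y)"
proof -
  obtain v k l where v: "v \<in> X" "f = shift (k, l) (ext v)" using assms by (rule desubstitution_at)
  obtain m i where m: "x + k = block_start (colw v) m + int i" "i < colw v m"
    using block_cases[of "colw v" "x + k", OF colw_pos] by blast
  obtain n j where n: "y + l = block_start (rowh v) n + int j" "j < rowh v n"
    using block_cases[of "rowh v" "y + l", OF rowh_pos] by blast
  have "quad_at f x y \<in> set (quad_image (quad_at v m n))"
    unfolding set_quad_image[OF v(1)] using v(2) m n by (auto simp: quad_at_shift)
  then have "quad_at f x y \<in> set (explore 7 [(11, 8, 6, 1)] [(11, 8, 6, 1)])"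
    using quad_image_explore quad_at_legal[OF v(1), of m n] by auto
  moreover have "\<forall>Q\<in>set (explore 7 [(11, 8, 6, 1)] [(11, 8, 6, 1)]). recurrent Q"
    by (rule recurrent_explore) (simp add: recurrent_seed del: One_nat_def)
  ultimately show ?thesis by blast
qed

section \<open>Copies of larger windows\<close>

definition copied ::
  "nat config \<Rightarrow> int set \<Rightarrow> int set \<Rightarrow> nat config \<Rightarrow> bool" where
  "copied f I J z \<longleftrightarrow> (\<exists>d e. \<forall>p\<in>I. \<forall>q\<in>J. z (p + d, q + e) = f (p, q))"

text \<open>A window of the image is covered by the blocks that it meets. A copy of the
  corresponding letters has the same widths and heights, so its image contains a copy of the
  window.\<close>

lemma copied_substitute:
  assumes y: "y \<in> X" and v: "v \<in> X"
    and copied: "copied y {block_of (colw y) (x0 + k)..block_of (colw y) (x1 + k)}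
        {block_of (rowh y) (y0 + l)..block_of (rowh y) (y1 + l)} v"
    and le: "x0 \<le> x1" "y0 \<le> y1"
  shows "copied (shift (k, l) (ext y)) {x0..x1} {y0..y1} (shift (k', l') (ext v))"
proof -
  define m0 m1 n0 n1 where "m0 = block_of (colw y) (x0 + k)" and "m1 = block_of (colw y) (x1 + k)"
    and "n0 = block_of (rowh y) (y0 + l)" and "n1 = block_of (rowh y) (y1 + l)"
  note defs = m0_def m1_def n0_def n1_def
  obtain d e where de': "\<forall>m\<in>{m0..m1}. \<forall>n\<in>{n0..n1}. v (m + d, n + e) = y (m, n)"
    using copied unfolding copied_def defs by blast
  have de: "v (m + d, n + e) = y (m, n)" if "m0 \<le> m" "m \<le> m1" "n0 \<le> n" "n \<le> n1" for m n
    using de' that by simp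
  have m01: "m0 \<le> m1" "n0 \<le> n1" unfolding defs using le by (intro block_of_mono; simp)+
  have c: "colw y m = colw v (m - m0 + (m0 + d))" if "m0 \<le> m" "m \<le> m1" for m
    using de[OF that order.refl m01(2)] X_cols[OF y, of m n0] X_cols[OF v, of "m + d" "n0 + e"] by simp
  have r: "rowh y n = rowh v (n - n0 + (n0 + e))" if "n0 \<le> n" "n \<le> n1" for n
    using de[OF order.refl m01(1) that] X_rows[OF y, of n m0] X_rows[OF v, of "n + e" "m0 + d"] by simp
  \<comment> \<open>On the copied letters the block starts of \<open>v\<close> and \<open>y\<close>
    differ by a constant in each direction; it is read off at the lower left block.\<close>
  define D where "D = block_start (colw v) (m0 + d) - block_start (colw y) m0"
  define E where "E = block_start (rowh v) (n0 + e) - block_start (rowh y) n0"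
  have D: "block_start (colw v) (m + d) = block_start (colw y) m + D" if "m0 \<le> m" "m \<le> m1" for m
    using block_start_cong[of m0 "m1 - m0 + 1" "colw y" "colw v" "m0 + d" "m - m0"] c that
    by (simp add: D_def algebra_simps)
  have E: "block_start (rowh v) (n + e) = block_start (rowh y) n + E" if "n0 \<le> n" "n \<le> n1" for n
    using block_start_cong[of n0 "n1 - n0 + 1" "rowh y" "rowh v" "n0 + e" "n - n0"] r that
    by (simp add: E_def algebra_simps)
  have "ext v (p + D, q + E) = ext y (p, q)"
    if pq: "x0 + k \<le> p" "p \<le> x1 + k" "y0 + l \<le> q" "q \<le> y1 + l" for p q
  proof -
    obtain m i where m: "p = block_start (colw y) m + int i" "i < colw y m" "block_of (colw y) p = m"
      using block_cases[of "colw y" p, OF colw_pos] by blast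
    obtain n j where n: "q = block_start (rowh y) n + int j" "j < rowh y n" "block_of (rowh y) q = n"
      using block_cases[of "rowh y" q, OF rowh_pos] by blast
    have "m0 \<le> m" "m \<le> m1" "n0 \<le> n" "n \<le> n1"
      unfolding defs m(3)[symmetric] n(3)[symmetric] using pq by (intro block_of_mono; simp)+
    note mn = this
    have "p + D = block_start (colw v) (m + d) + int i" "q + E = block_start (rowh v) (n + e) + int j"
      using m(1) n(1) D E mn by simp_all
    then have "ext v (p + D, q + E) = cell (v (m + d, n + e)) i j"
      using c[of m] r[of n] m(2) n(2) mn by (simp add: ext_block)
    also have "\<dots> = ext y (p, q)" using de[OF mn] ext_block[OF m(2) n(2)] m(1) n(1) by simp
    finally show ?thesis .
  qed
  note ext = this
  have "shift (k', l') (ext v) (p + (k + D - k'), q + (l + E - l')) = shift (k, l) (ext y) (p, q)"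
    if "p \<in> {x0..x1}" "q \<in> {y0..y1}" for p q
    using ext[of "p + k" "q + l"] that by (simp add: algebra_simps)
  then show ?thesis unfolding copied_def by blast
qed

lemma block_of_contract:
  assumes pos: "\<And>m. 0 < h m" and "p \<le> q"
  shows "block_of h q - block_of h p \<le> q - p"
proof (cases "block_of h p + 1 \<le> block_of h q")
  case True
  then show ?thesis
    using block_start_diff_ge[of h, OF pos True] block_of_bounds[of h p, OF pos]
      block_of_bounds[of h q, OF pos] block_start_Suc[of h "block_of h p"] by linarith
qed (use assms in linarith)

text \<open>
  One desubstitution step need not shrink a window of three columns, but two steps roughly halve
  every window.
\<close>

lemma two_level_cover:
  assumes pos: "\<And>m. 0 < h m"
    and g: "\<And>m. g m = (if block_start h (block_of h (m + l)) = m + l then 2 else 1 :: nat)"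
    and "x0 \<le> x1"
  shows "2 * (block_of h (block_of g x1 + l) - block_of h (block_of g x0 + l)) \<le> x1 - x0 + 1"
proof -
  have posg: "0 < g m" for m by (simp add: g)
  let ?B = "\<lambda>m. block_of h (m + l)"
  \<comment> \<open>A block of \<open>g\<close> has length \<open>2\<close> exactly where an
    \<open>h\<close>-block starts, that is, where \<open>?B\<close> increases by one. Summing up,
    the cells of consecutive \<open>g\<close>-blocks count the blocks plus the
    \<open>h\<close>-boundaries crossed.\<close>
  have g_eq: "int (g m) = 1 + (?B m - ?B (m - 1))" for m
    using block_of_Suc[of h "m - 1 + l", OF pos] block_of_bounds[of h "m - 1 + l", OF pos]
    by (auto simp: g algebra_simps split: if_splits)
  have sum: "block_start g m' - block_start g m = (m' - m) + (?B (m' - 1) - ?B (m - 1))"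
    if "m \<le> m'" for m m'
    using that
  proof (induction m' rule: int_ge_induct)
    case (step m')
    then show ?case using g_eq[of m'] by (simp add: block_start_Suc)
  qed simp
  let ?m0 = "block_of g x0" and ?m1 = "block_of g x1"
  show ?thesis
  proof (cases "?m0 + 1 \<le> ?m1")
    case True
    have "block_start g ?m1 - block_start g (?m0 + 1) = (?m1 - ?m0 - 1) + (?B (?m1 - 1) - ?B ?m0)"
      using sum[OF True] by simp
    moreover have "x0 + 1 \<le> block_start g (?m0 + 1)" "block_start g ?m1 \<le> x1"
      using block_of_bounds[of g, OF posg] block_start_Suc[of g ?m0] by (simp_all add: zless_imp_add1_zle)
    ultimately have "(?m1 - ?m0) + (?B (?m1 - 1) - ?B ?m0) \<le> x1 - x0" by simp
    \<comment> \<open>Passing from \<open>?m1 - 1\<close> to \<open>?m1\<close> crosses at most one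
      \<open>h\<close>-boundary, which is the \<open>+ 1\<close> in the bound.\<close>
    moreover have "?B ?m1 - ?B (?m1 - 1) \<le> 1"
      using block_of_contract[of h "?m1 - 1 + l" "?m1 + l", OF pos] by simp
    moreover have "?B ?m1 - ?B ?m0 \<le> ?m1 - ?m0"
      using block_of_contract[of h "?m0 + l" "?m1 + l", OF pos] True by simp
    ultimately show ?thesis by simp
  next
    case False
    then have "?m1 = ?m0" using block_of_mono[of g x0 x1, OF posg] assms(3) by simp
    then show ?thesis using assms(3) by simp
  qed
qed

lemma narrow_low_ext_iff:
  assumes w: "w \<in> X"
  shows "narrow (ext w (p, q)) \<longleftrightarrow> block_start (colw w) (block_of (colw w) p) \<noteq> p"
    "low (ext w (p, q)) \<longleftrightarrow> block_start (rowh w) (block_of (rowh w) q) \<noteq> q"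
proof -
  obtain m i where m: "p = block_start (colw w) m + int i" "i < colw w m" "block_of (colw w) p = m"
    using block_cases[of "colw w" p, OF colw_pos] by blast
  obtain n j where n: "q = block_start (rowh w) n + int j" "j < rowh w n" "block_of (rowh w) q = n"
    using block_cases[of "rowh w" q, OF rowh_pos] by blast
  have "i < 2" "j < 2" using m(2) n(2) X_cols_cases[of w m] X_rows_cases[of w n] by auto
  then show "narrow (ext w (p, q)) \<longleftrightarrow> block_start (colw w) (block_of (colw w) p) \<noteq> p"
    "low (ext w (p, q)) \<longleftrightarrow> block_start (rowh w) (block_of (rowh w) q) \<noteq> q"
    unfolding m(3) n(3) using narrow_low_ext[OF w m(2) n(2)] m(1) n(1) by auto
qed

text \<open>This is the relation between \<open>g\<close> and \<open>h\<close> that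
  \<open>two_level_cover\<close> assumes, for a configuration and its preimage.\<close>

lemma colw_rowh_shift_ext:
  assumes w: "w \<in> X"
  shows "colw (shift (k, l) (ext w)) m =
      (if block_start (colw w) (block_of (colw w) (m + k)) = m + k then 2 else 1)"
    "rowh (shift (k, l) (ext w)) n =
      (if block_start (rowh w) (block_of (rowh w) (n + l)) = n + l then 2 else 1)"
  by (simp_all add: col_width_def row_height_def wd_def ht_def narrow_low_ext_iff[OF w])

definition repetitive :: "int \<Rightarrow> bool" where
  "repetitive N \<longleftrightarrow> (\<forall>f\<in>X. \<forall>z\<in>X. \<forall>x0 x1 y0 y1.
     x0 \<le> x1 \<longrightarrow> x1 < x0 + N \<longrightarrow> y0 \<le> y1 \<longrightarrow> y1 < y0 + N \<longrightarrow> copied f {x0..x1} {y0..y1} z)"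

lemma repetitive_2: "repetitive 2"
  unfolding repetitive_def
proof (intro ballI allI impI)
  fix f z :: "nat config" and x0 x1 y0 y1 :: int
  assume f: "f \<in> X" and z: "z \<in> X" and *: "x0 \<le> x1" "x1 < x0 + 2" "y0 \<le> y1" "y1 < y0 + 2"
  obtain m n where mn: "quad_at z m n = quad_at f x0 y0"
    using quad_at_recurrent[OF f] z unfolding recurrent_def by blast
  have "z (p + (m - x0), q + (n - y0)) = f (p, q)" if "p \<in> {x0..x1}" "q \<in> {y0..y1}" for p q
  proof -
    have "p = x0 \<or> p = x0 + 1" "q = y0 \<or> q = y0 + 1" using that * by auto
    then show ?thesis using mn by (auto simp: quad_at_def add.commute[of 1])
  qed
  then show "copied f {x0..x1} {y0..y1} z" unfolding copied_def by blast
qed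

text \<open>After two desubstitutions the end blocks of the covering window have indices at most
  \<open>(N + 1) / 2\<close> apart, which is less than \<open>N\<close> as \<open>N\<close> is at
  least \<open>2\<close>. So that window is copied, and substituting twice copies the original
  one.\<close>

lemma repetitive_step:
  assumes N: "2 \<le> N" and rep: "repetitive N"
  shows "repetitive (N + 1)"
  unfolding repetitive_def
proof (intro ballI allI impI)
  fix f z :: "nat config" and x0 x1 y0 y1 :: int
  assume f: "f \<in> X" and z: "z \<in> X" and xy: "x0 \<le> x1" "x1 < x0 + (N + 1)" "y0 \<le> y1" "y1 < y0 + (N + 1)"
  obtain y k l where y: "y \<in> X" "f = shift (k, l) (ext y)" using desubstitution_at[OF f] .
  obtain v k' l' where v: "v \<in> X" "z = shift (k', l') (ext v)" using desubstitution_at[OF z] .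
  obtain w a b where w: "w \<in> X" "y = shift (a, b) (ext w)" using desubstitution_at[OF y(1)] .
  obtain u a' b' where u: "u \<in> X" "v = shift (a', b') (ext u)" using desubstitution_at[OF v(1)] .
  let ?m0 = "block_of (colw y) (x0 + k)" and ?m1 = "block_of (colw y) (x1 + k)"
  let ?n0 = "block_of (rowh y) (y0 + l)" and ?n1 = "block_of (rowh y) (y1 + l)"
  have mn: "?m0 \<le> ?m1" "?n0 \<le> ?n1" using xy by (intro block_of_mono; simp)+
  have "2 * (block_of (colw w) (?m1 + a) - block_of (colw w) (?m0 + a)) \<le> x1 + k - (x0 + k) + 1"
    by (rule two_level_cover) (use xy in \<open>simp_all add: w(2) colw_rowh_shift_ext[OF w(1)]\<close>)
  moreover have "2 * (block_of (rowh w) (?n1 + b) - block_of (rowh w) (?n0 + b)) \<le> y1 + l - (y0 + l) + 1"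
    by (rule two_level_cover) (use xy in \<open>simp_all add: w(2) colw_rowh_shift_ext[OF w(1)]\<close>)
  ultimately have "block_of (colw w) (?m1 + a) < block_of (colw w) (?m0 + a) + N"
    "block_of (rowh w) (?n1 + b) < block_of (rowh w) (?n0 + b) + N"
    using xy N by simp_all
  moreover have "block_of (colw w) (?m0 + a) \<le> block_of (colw w) (?m1 + a)"
    "block_of (rowh w) (?n0 + b) \<le> block_of (rowh w) (?n1 + b)"
    using mn by (intro block_of_mono; simp)+
  ultimately have "copied w {block_of (colw w) (?m0 + a)..block_of (colw w) (?m1 + a)}
      {block_of (rowh w) (?n0 + b)..block_of (rowh w) (?n1 + b)} u"
    using rep w(1) u(1) unfolding repetitive_def by blast
  then have "copied y {?m0..?m1} {?n0..?n1} v"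
    unfolding w(2) u(2) using w(1) u(1) mn[unfolded w(2)] by (intro copied_substitute)
  then show "copied f {x0..x1} {y0..y1} z"
    unfolding y(2) v(2) using y(1) v(1) xy by (intro copied_substitute)
qed

lemma repetitive: "2 \<le> N \<Longrightarrow> repetitive N"
  by (induction N rule: int_ge_induct) (auto intro: repetitive_2 repetitive_step)

lemma open_config_finite:
  fixes U :: "nat config set"
  assumes "open U" "f \<in> U"
  obtains D where "finite D" "\<And>g. (\<forall>n\<in>D. g n = f n) \<Longrightarrow> g \<in> U"
proof -
  have "openin (product_topology (\<lambda>i. euclidean) UNIV) U" using assms(1) by (simp add: open_fun_def)
  from product_topology_open_contains_basis[OF this assms(2)]
  obtain B where B: "f \<in> PiE UNIV B" "finite {i. B i \<noteq> UNIV}" "PiE UNIV B \<subseteq> U" by auto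
  have "g \<in> U" if "\<forall>n\<in>{i. B i \<noteq> UNIV}. g n = f n" for g
  proof -
    have "g n \<in> B n" for n
    proof (cases "B n = UNIV")
      case False
      then have "g n = f n" using that by blast
      moreover have "f n \<in> B n" using B(1) by (auto simp: PiE_UNIV_domain)
      ultimately show ?thesis by simp
    qed simp
    then show ?thesis using B(3) by (auto simp: PiE_UNIV_domain)
  qed
  then show ?thesis using that B(2) by blast
qed

text \<open>Membership of \<open>f\<close> in the open complement of \<open>Y\<close> depends on
  finitely many cells. A point of \<open>Y\<close> contains a copy of \<open>f\<close> on a window
  around these cells, so one of its shifts would leave \<open>Y\<close>.\<close>

lemma X_minimal: "minimal_subshift X"
  unfolding minimal_subshift_def
proof (rule conjI[OF X_nonempty notI])
  assume "\<exists>Y. Y \<noteq> {} \<and> Y \<subset> X \<and> closed Y \<and> shift_invariant Y"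
  then obtain Y where Y: "Y \<noteq> {}" "Y \<subset> X" "closed Y" "shift_invariant Y" by blast
  obtain z f where z: "z \<in> Y" "z \<in> X" and f: "f \<in> X" "f \<in> - Y" using Y(1,2) by blast
  obtain D where D: "finite D" "\<And>g. (\<forall>n\<in>D. g n = f n) \<Longrightarrow> g \<in> - Y"
    using open_config_finite[OF _ f(2)] Y(3) by (metis open_Compl)
  define M where "M = Max (insert 0 ((\<lambda>n. \<bar>fst n\<bar> + \<bar>snd n\<bar>) ` D))"
  have M: "\<bar>fst n\<bar> + \<bar>snd n\<bar> \<le> M" if "n \<in> D" for n
    unfolding M_def using D(1) that by (intro Max_ge) auto
  have "0 \<le> M" unfolding M_def using D(1) by (intro Max_ge) auto
  \<comment> \<open>The size \<open>2 * M + 2\<close> exceeds the side \<open>2 * M + 1\<close> by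
    one, so that it is at least \<open>2\<close> even for \<open>M = 0\<close>.\<close>
  have "copied f {- M..M} {- M..M} z"
    using repetitive[of "2 * M + 2"] f(1) z(2) \<open>0 \<le> M\<close> unfolding repetitive_def by simp
  then obtain d e where de: "\<And>p q. p \<in> {- M..M} \<Longrightarrow> q \<in> {- M..M} \<Longrightarrow> z (p + d, q + e) = f (p, q)"
    unfolding copied_def by blast
  have "shift (d, e) z n = f n" if "n \<in> D" for n
    using M[OF that] by (cases n) (auto intro!: de)
  then have "shift (d, e) z \<in> - Y" using D(2) by blast
  moreover have "shift (d, e) z \<in> Y" using Y(4) z(1) unfolding shift_invariant_def by blast
  ultimately show False by blast
qed

theorem theorem3:
  shows "self_similar {0..15} (wang_shift Z_tiles)
       \<and> minimal_subshift (wang_shift Z_tiles)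
       \<and> aperiodic_subshift (wang_shift Z_tiles)"
  using X_self_similar X_minimal X_aperiodic by blast

end
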